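(* Let $n\ge 3$, let $K$ be a field, let $X=(x_{ij})_{1\le i,j\le n}$ and $Y=(y_{ij})_{1\le i,j\le n}$ be matrices of independent indeterminates over $K$, let $R=K[X,Y]$ be the polynomial ring in all these $2n^2$ variables, and let $C=XY-YX=(c_{ij})$. Let $I$ be the ideal of $R$ generated by the diagonal entries $c_{ii}$ ($1\le i\le n$) of $C$. Then the elements $$x_{11},$$ $$x_{ij}\quad\text{where }2\le i\le n,\ 1\le j\le n,$$ $$y_{ij}\quad\text{where }1\le i\le n,\ 2\le j\le n,$$ $$x_{1j}-y_{j1}\quad\text{where }1\le j\le n,$$ form a homogeneous system of parameters and a regular sequence on $R/I$.
   Context: $R$ is graded by total degree with all variables of degree $1$. A homogeneous system of parameters for a quotient $R/\mathfrak a$ by a homogeneous ideal $\mathfrak a$ is a sequence of $\dim(R/\mathfrak a)$ homogeneous elements of positive degree such that the quotient of $R/\mathfrak a$ by the ideal they generate has Krull dimension $0$. *)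

theory Defs
  imports
    "HOL-Library.Poly_Mapping"
    "HOL-Library.Extended_Real"
    "HOL-Algebra.QuotRing"
    "Jordan_Normal_Form.Matrix"
begin

section \<open>Krull dimension and regular sequences\<close>

text \<open>The zero ring has no prime ideals and hence Krull dimension \<open>- \<infinity>\<close>;
  in particular dimension \<open>0\<close> entails that the ring is nonzero.\<close>

definition krull_dim :: "('a, 'b) ring_scheme \<Rightarrow> ereal" where
  "krull_dim A = Sup {ereal (real d) | d :: nat. \<exists>P :: nat \<Rightarrow> 'a set.
     (\<forall>i\<le>d. primeideal (P i) A) \<and> (\<forall>i<d. P i \<subset> P (Suc i))}"

definition nonzerodivisor :: "('a, 'b) ring_scheme \<Rightarrow> 'a \<Rightarrow> bool" where
  "nonzerodivisor A a \<longleftrightarrow>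
     a \<in> carrier A \<and> (\<forall>b\<in>carrier A. a \<otimes>\<^bsub>A\<^esub> b = \<zero>\<^bsub>A\<^esub> \<longrightarrow> b = \<zero>\<^bsub>A\<^esub>)"

definition regular_sequence :: "('a, 'b) ring_scheme \<Rightarrow> 'a list \<Rightarrow> bool" where
  "regular_sequence A gs \<longleftrightarrow>
     set gs \<subseteq> carrier A \<and>
     (\<forall>i<length gs. let J = genideal A (set (take i gs))
        in nonzerodivisor (A Quot J) (J +>\<^bsub>A\<^esub> (gs ! i))) \<and>
     genideal A (set gs) \<noteq> carrier A"


section \<open>Graded polynomial rings\<close>

text \<open>A monomial is a finitely supported exponent vector, a polynomial a finitely supported
  family of coefficients indexed by monomials.\<close>

type_synonym ('v, 'k) mpoly = "('v \<Rightarrow>\<^sub>0 nat) \<Rightarrow>\<^sub>0 'k"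

definition mpoly_ring :: "'v set \<Rightarrow> ('v, 'k::comm_ring_1) mpoly ring" where
  "mpoly_ring V =
     \<lparr>carrier = {p. \<forall>m\<in>Poly_Mapping.keys p. Poly_Mapping.keys m \<subseteq> V},
      monoid.mult = (*), one = 1, zero = 0, add = (+)\<rparr>"

lemma cring_mpoly_ring: "cring (mpoly_ring V :: ('v, 'k::comm_ring_1) mpoly ring)"
proof (rule cringI)
  show "abelian_group (mpoly_ring V :: ('v, 'k) mpoly ring)"
  proof (rule abelian_groupI)
    fix p q :: "('v, 'k) mpoly"
    assume "p \<in> carrier (mpoly_ring V)" "q \<in> carrier (mpoly_ring V)"
    then show "p \<oplus>\<^bsub>mpoly_ring V\<^esub> q \<in> carrier (mpoly_ring V)"
      using Poly_Mapping.keys_add[of p q] by (auto simp: mpoly_ring_def)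
  next
    fix p :: "('v, 'k) mpoly"
    assume "p \<in> carrier (mpoly_ring V)"
    then show "\<exists>q\<in>carrier (mpoly_ring V). q \<oplus>\<^bsub>mpoly_ring V\<^esub> p = \<zero>\<^bsub>mpoly_ring V\<^esub>"
      by (intro bexI[of _ "- p"]) (auto simp: mpoly_ring_def)
  qed (auto simp: mpoly_ring_def algebra_simps)
  show "comm_monoid (mpoly_ring V :: ('v, 'k) mpoly ring)"
  proof (rule comm_monoidI)
    fix p q :: "('v, 'k) mpoly"
    assume p: "p \<in> carrier (mpoly_ring V)" and q: "q \<in> carrier (mpoly_ring V)"
    have "Poly_Mapping.keys m \<subseteq> V" if "m \<in> Poly_Mapping.keys (p * q)" for m
    proof -
      obtain a b where "m = a + b" "a \<in> Poly_Mapping.keys p" "b \<in> Poly_Mapping.keys q"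
        using \<open>m \<in> Poly_Mapping.keys (p * q)\<close> Poly_Mapping.keys_mult[of p q] by blast
      then show ?thesis
        using p q Poly_Mapping.keys_add[of a b] unfolding mpoly_ring_def by fastforce
    qed
    then show "p \<otimes>\<^bsub>mpoly_ring V\<^esub> q \<in> carrier (mpoly_ring V)"
      by (simp add: mpoly_ring_def)
  qed (auto simp: mpoly_ring_def algebra_simps)
qed (auto simp: mpoly_ring_def algebra_simps)

definition mpoly_var :: "'v \<Rightarrow> ('v, 'k::comm_ring_1) mpoly" where
  "mpoly_var v = Poly_Mapping.single (Poly_Mapping.single v 1) 1"

definition total_deg :: "('v \<Rightarrow>\<^sub>0 nat) \<Rightarrow> nat" where
  "total_deg m = (\<Sum>v\<in>Poly_Mapping.keys m. Poly_Mapping.lookup m v)"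

definition homogeneous :: "nat \<Rightarrow> ('v, 'k::comm_ring_1) mpoly \<Rightarrow> bool" where
  "homogeneous d p \<longleftrightarrow> (\<forall>m\<in>Poly_Mapping.keys p. total_deg m = d)"

definition homogeneous_ideal :: "'v set \<Rightarrow> ('v, 'k::comm_ring_1) mpoly set \<Rightarrow> bool" where
  "homogeneous_ideal V \<aa> \<longleftrightarrow>
     (\<exists>S \<subseteq> carrier (mpoly_ring V). (\<forall>p\<in>S. \<exists>d. homogeneous d p) \<and> \<aa> = genideal (mpoly_ring V) S)"

text \<open>The degree \<open>d\<close> part of the quotient by \<open>\<aa>\<close>, with respect to the induced grading.\<close>

definition quot_degree_part ::
    "'v set \<Rightarrow> ('v, 'k::comm_ring_1) mpoly set \<Rightarrow> nat \<Rightarrow> ('v, 'k) mpoly set set" where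
  "quot_degree_part V \<aa> d =
     {\<aa> +>\<^bsub>mpoly_ring V\<^esub> p | p. p \<in> carrier (mpoly_ring V) \<and> homogeneous d p}"

definition hsop ::
    "'v set \<Rightarrow> ('v, 'k::field) mpoly set \<Rightarrow> ('v, 'k) mpoly set list \<Rightarrow> bool" where
  "hsop V \<aa> gs \<longleftrightarrow> (let A = mpoly_ring V Quot \<aa> in
     homogeneous_ideal V \<aa> \<and>
     (\<forall>g\<in>set gs. \<exists>d>0. g \<in> quot_degree_part V \<aa> d) \<and>
     ereal (real (length gs)) = krull_dim A \<and>
     krull_dim (A Quot genideal A (set gs)) = 0)"


section \<open>The diagonal of the commutator of two generic matrices\<close>

text \<open>Indices run from \<open>0\<close> to \<open>n - 1\<close>, as for library matrices: \<open>xvar i j\<close> is the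
  entry usually written with indices \<open>i + 1\<close>, \<open>j + 1\<close>.\<close>

datatype entry = XE nat nat | YE nat nat

definition entries :: "nat \<Rightarrow> entry set" where
  "entries n = {XE i j | i j. i < n \<and> j < n} \<union> {YE i j | i j. i < n \<and> j < n}"

definition xvar :: "nat \<Rightarrow> nat \<Rightarrow> (entry, 'k::field) mpoly" where
  "xvar i j = mpoly_var (XE i j)"

definition yvar :: "nat \<Rightarrow> nat \<Rightarrow> (entry, 'k::field) mpoly" where
  "yvar i j = mpoly_var (YE i j)"

definition generic_X :: "nat \<Rightarrow> (entry, 'k::field) mpoly mat" where
  "generic_X n = mat n n (\<lambda>(i, j). xvar i j)"

definition generic_Y :: "nat \<Rightarrow> (entry, 'k::field) mpoly mat" where
  "generic_Y n = mat n n (\<lambda>(i, j). yvar i j)"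

definition commutator :: "nat \<Rightarrow> (entry, 'k::field) mpoly mat" where
  "commutator n = generic_X n * generic_Y n - generic_Y n * generic_X n"

definition polyR :: "nat \<Rightarrow> (entry, 'k::field) mpoly ring" where
  "polyR n = mpoly_ring (entries n)"

definition diag_ideal :: "nat \<Rightarrow> (entry, 'k::field) mpoly set" where
  "diag_ideal n = genideal (polyR n) {commutator n $$ (i, i) | i. i < n}"

definition parameters :: "nat \<Rightarrow> (entry, 'k::field) mpoly list" where
  "parameters n =
     [xvar 0 0]
     @ [xvar i j. i \<leftarrow> [1..<n], j \<leftarrow> [0..<n]]
     @ [yvar i j. i \<leftarrow> [0..<n], j \<leftarrow> [1..<n]]
     @ [xvar 0 j - yvar j 0. j \<leftarrow> [0..<n]]"

end

theory Submission
  imports Defs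
begin

text \<open>
  Indices run from \<open>1\<close> in this overview. The linear substitution \<open>\<sigma>\<close> that replaces \<open>y\<^bsub>j1\<^esub>\<close> by
  \<open>x\<^bsub>1j\<^esub> - y\<^bsub>j1\<^esub>\<close> is an involution of \<open>R\<close>. It turns
  the parameters into variables, namely into all of them except \<open>t\<^bsub>i\<^esub> = x\<^bsub>1i\<^esub>\<close> for \<open>i \<ge> 2\<close>. Let \<open>S\<close>
  be the polynomial ring in these \<open>m = 2n\<^sup>2 - n + 1\<close> variables. For \<open>i \<ge> 2\<close> the diagonal entry \<open>c\<^bsub>ii\<^esub>\<close>
  contains the product \<open>y\<^bsub>i1\<^esub> x\<^bsub>1i\<^esub>\<close>, and no other term of it involves \<open>x\<^bsub>1i\<^esub>\<close> or a variable changed by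
  \<open>\<sigma>\<close>. So \<open>\<sigma> c\<^bsub>ii\<^esub> = - (t\<^bsub>i\<^esub>\<^sup>2 - a\<^bsub>i\<^esub> t\<^bsub>i\<^esub> - b\<^bsub>i\<^esub>)\<close> with \<open>a\<^bsub>i\<^esub>, b\<^bsub>i\<^esub> \<in> S\<close> (\<open>\<sigma>_commutator\<close>). The remaining
  entry \<open>c\<^bsub>11\<^esub>\<close> is minus the sum of the others because commutators have trace zero. Hence,
  after applying \<open>\<sigma>\<close>, \<open>R/I\<close> is obtained from \<open>S\<close> by adjoining a root of one monic quadratic for every \<open>i \<ge> 2\<close>; it is a
  free \<open>S\<close>-module on the squarefree monomials in the \<open>t\<^bsub>i\<^esub>\<close>.

  Everything follows from this. Reduction of powers of the \<open>t\<^bsub>i\<^esub>\<close> is an \<open>S\<close>-linear map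
  (\<open>normal_form\<close>) that kills the quadratics and changes a polynomial only modulo them. It carries a
  relation \<open>z p \<in> I + (F)\<close>, with \<open>F\<close> a set of variables of \<open>S\<close> and \<open>z\<close> another such variable, to a
  relation modulo the monomial ideal \<open>(F)\<close>, where \<open>z\<close> can be cancelled monomial by monomial
  (\<open>base_variable_cancel\<close>). This proves regularity of the parameters in every order.

  The dimension of \<open>R/I\<close> is at most \<open>m\<close> because normal forms of degree at most \<open>d\<close> span a space of
  dimension \<open>O(d\<^sup>m)\<close>, so that any \<open>m + 1\<close> elements are algebraically dependent modulo \<open>I\<close>, whereas
  elements picked from the successive steps of a chain of primes are algebraically independent
  (\<open>prime_chain_length_le\<close>). It is at least \<open>m\<close> because \<open>m\<close> coordinates of a generic point of some
  component of the zero set of \<open>I\<close> can be prescribed freely: solving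
  \<open>c\<^bsub>ii\<^esub> = 0\<close> for \<open>x\<^bsub>i1\<^esub>\<close>, \<open>i \<ge> 2\<close>, gives a parametrization by an \<open>m\<close>-dimensional affine space, along which parameters can be specialized one at a time
  (\<open>exists_parametrization\<close>, \<open>prime_chain_of_parametrization\<close>). Finally a prime that contains \<open>I\<close>
  and all parameters contains \<open>y\<^bsub>i1\<^esub> x\<^bsub>1i\<^esub>\<close> for \<open>i \<ge> 2\<close>, hence every variable, so that only the maximal ideal
  of the origin remains and the last quotient has dimension zero.
\<close>

section \<open>Quotients, primes and Krull dimension\<close>

lemma primeideal_vimage:
  assumes h: "ring_hom_ring R S h" and R: "cring R" and P: "primeideal P S"
  shows "primeideal {r \<in> carrier R. h r \<in> P} R"
proof -
  interpret h: ring_hom_ring R S h by (rule h)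
  interpret P: primeideal P S by (rule P)
  show ?thesis
  proof (rule primeidealI[OF _ R])
    show "ideal {r \<in> carrier R. h r \<in> P} R"
      by (rule h.ideal_vimage[OF P.is_ideal])
    have "\<one>\<^bsub>R\<^esub> \<notin> {r \<in> carrier R. h r \<in> P}"
      using P.one_imp_carrier P.I_notcarr by auto
    then show "carrier R \<noteq> {r \<in> carrier R. h r \<in> P}"
      by (metis h.R.one_closed)
    fix a b assume "a \<in> carrier R" "b \<in> carrier R" "a \<otimes>\<^bsub>R\<^esub> b \<in> {r \<in> carrier R. h r \<in> P}"
    then show "a \<in> {r \<in> carrier R. h r \<in> P} \<or> b \<in> {r \<in> carrier R. h r \<in> P}"
      using P.I_prime[of "h a" "h b"] by auto
  qed
qed

lemma image_mem_iff:
  assumes h: "ring_hom_ring R S h" and P: "ideal P R"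
    and ker: "\<And>r. r \<in> carrier R \<Longrightarrow> h r = \<zero>\<^bsub>S\<^esub> \<Longrightarrow> r \<in> P" and r: "r \<in> carrier R"
  shows "h r \<in> h ` P \<longleftrightarrow> r \<in> P"
proof
  interpret h: ring_hom_ring R S h by (rule h)
  interpret P: ideal P R by (rule P)
  assume "h r \<in> h ` P"
  then obtain p where p: "p \<in> P" "h r = h p" by auto
  have pc: "p \<in> carrier R" using p by (simp add: P.a_Hcarr)
  have "h (r \<ominus>\<^bsub>R\<^esub> p) = \<zero>\<^bsub>S\<^esub>"
    using p(2) r pc by (simp add: a_minus_def h.S.r_neg)
  then have "r \<ominus>\<^bsub>R\<^esub> p \<in> P" using ker r pc by simp
  then have "(r \<ominus>\<^bsub>R\<^esub> p) \<oplus>\<^bsub>R\<^esub> p \<in> P" using p by simp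
  moreover have "(r \<ominus>\<^bsub>R\<^esub> p) \<oplus>\<^bsub>R\<^esub> p = r"
    using r pc by (simp add: a_minus_def h.R.a_assoc h.R.l_neg)
  ultimately show "r \<in> P" by simp
qed auto

lemma ideal_image:
  assumes h: "ring_hom_ring R S h" and surj: "h ` carrier R = carrier S" and P: "ideal P R"
  shows "ideal (h ` P) S"
proof -
  interpret h: ring_hom_ring R S h by (rule h)
  interpret P: ideal P R by (rule P)
  have sub: "P \<subseteq> carrier R" by (rule P.a_subset)
  show ?thesis
  proof (rule idealI)
    show "ring S" by (rule h.S.ring_axioms)
    show "subgroup (h ` P) (add_monoid S)"
      by (rule h.img_is_add_subgroup) (rule P.additive_subgroup_axioms[THEN additive_subgroup.a_subgroup])
    fix a x assume "a \<in> h ` P" "x \<in> carrier S"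
    then obtain p r where p: "p \<in> P" "a = h p" and r: "r \<in> carrier R" "x = h r"
      using surj by blast
    have pc: "p \<in> carrier R" using p sub by auto
    have "x \<otimes>\<^bsub>S\<^esub> a = h (r \<otimes>\<^bsub>R\<^esub> p)" "a \<otimes>\<^bsub>S\<^esub> x = h (p \<otimes>\<^bsub>R\<^esub> r)" using p r pc by auto
    then show "x \<otimes>\<^bsub>S\<^esub> a \<in> h ` P" "a \<otimes>\<^bsub>S\<^esub> x \<in> h ` P"
      using P.I_l_closed[OF p(1) r(1)] P.I_r_closed[OF p(1) r(1)] by auto
  qed
qed

lemma primeideal_image:
  assumes h: "ring_hom_ring R S h" and S: "cring S" and surj: "h ` carrier R = carrier S"
    and P: "primeideal P R"
    and ker: "\<And>r. r \<in> carrier R \<Longrightarrow> h r = \<zero>\<^bsub>S\<^esub> \<Longrightarrow> r \<in> P"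
  shows "primeideal (h ` P) S"
proof -
  interpret h: ring_hom_ring R S h by (rule h)
  interpret P: primeideal P R by (rule P)
  have mem: "h r \<in> h ` P \<longleftrightarrow> r \<in> P" if "r \<in> carrier R" for r
    by (rule image_mem_iff[OF h P.is_ideal ker that])
  show ?thesis
  proof (rule primeidealI[OF ideal_image[OF h surj P.is_ideal] S])
    have "\<one>\<^bsub>R\<^esub> \<notin> P" using P.one_imp_carrier P.I_notcarr by auto
    then have "h \<one>\<^bsub>R\<^esub> \<notin> h ` P" using mem[of "\<one>\<^bsub>R\<^esub>"] by (simp del: h.hom_one)
    then show "carrier S \<noteq> h ` P" by (metis h.hom_closed h.R.one_closed)
    fix a b assume "a \<in> carrier S" "b \<in> carrier S" and ab: "a \<otimes>\<^bsub>S\<^esub> b \<in> h ` P"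
    then obtain x y where x: "x \<in> carrier R" "a = h x" and y: "y \<in> carrier R" "b = h y"
      using surj by blast
    have "h (x \<otimes>\<^bsub>R\<^esub> y) \<in> h ` P" using ab x y by simp
    then have "x \<otimes>\<^bsub>R\<^esub> y \<in> P" using mem[of "x \<otimes>\<^bsub>R\<^esub> y"] x y by (simp del: h.hom_mult)
    then show "a \<in> h ` P \<or> b \<in> h ` P" using P.I_prime[OF x(1) y(1)] x y by auto
  qed
qed

text \<open>Inverse images and images match chains of primes of the target with chains of primes
  of the source above the kernel, so that every dimension below is computed in the
  polynomial ring itself.\<close>

lemma krull_dim_surjective_image:
  fixes R :: "('a, 'c) ring_scheme" and S :: "('b, 'd) ring_scheme"
  assumes h: "ring_hom_ring R S h" and R: "cring R" and S: "cring S"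
    and surj: "h ` carrier R = carrier S"
  shows "krull_dim S = Sup {ereal (real d) | d. \<exists>P :: nat \<Rightarrow> 'a set.
     (\<forall>i\<le>d. primeideal (P i) R \<and> {r \<in> carrier R. h r = \<zero>\<^bsub>S\<^esub>} \<subseteq> P i) \<and>
     (\<forall>i<d. P i \<subset> P (Suc i))}"
proof -
  interpret h: ring_hom_ring R S h by (rule h)
  have "(\<exists>P :: nat \<Rightarrow> 'b set. (\<forall>i\<le>d. primeideal (P i) S) \<and> (\<forall>i<d. P i \<subset> P (Suc i)))
    \<longleftrightarrow> (\<exists>P :: nat \<Rightarrow> 'a set.
     (\<forall>i\<le>d. primeideal (P i) R \<and> {r \<in> carrier R. h r = \<zero>\<^bsub>S\<^esub>} \<subseteq> P i) \<and>
     (\<forall>i<d. P i \<subset> P (Suc i)))" (is "?L \<longleftrightarrow> ?R") for d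
  proof
    assume ?L
    then obtain P where P: "\<And>i. i \<le> d \<Longrightarrow> primeideal (P i) S" "\<And>i. i < d \<Longrightarrow> P i \<subset> P (Suc i)"
      by blast
    define Q where "Q i = {r \<in> carrier R. h r \<in> P i}" for i
    have "primeideal (Q i) R \<and> {r \<in> carrier R. h r = \<zero>\<^bsub>S\<^esub>} \<subseteq> Q i" if "i \<le> d" for i
    proof
      show "primeideal (Q i) R"
        unfolding Q_def by (rule primeideal_vimage[OF h R P(1)[OF that]])
      interpret P: primeideal "P i" S by (rule P(1)[OF that])
      show "{r \<in> carrier R. h r = \<zero>\<^bsub>S\<^esub>} \<subseteq> Q i" by (auto simp: Q_def)
    qed
    moreover have "Q i \<subset> Q (Suc i)" if "i < d" for i
    proof -
      obtain s where s: "s \<in> P (Suc i)" "s \<notin> P i" using P(2)[OF \<open>i < d\<close>] by blast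
      interpret P: primeideal "P (Suc i)" S by (rule P(1)) (use that in simp)
      have "s \<in> carrier S" using s P.a_Hcarr by simp
      then obtain r where "r \<in> carrier R" "s = h r" using surj by blast
      then have "r \<in> Q (Suc i)" "r \<notin> Q i" using s by (auto simp: Q_def)
      moreover have "Q i \<subseteq> Q (Suc i)" using P(2)[OF \<open>i < d\<close>] by (auto simp: Q_def)
      ultimately show ?thesis by blast
    qed
    ultimately show ?R by blast
  next
    assume ?R
    then obtain P where P: "\<And>i. i \<le> d \<Longrightarrow> primeideal (P i) R"
      "\<And>i. i \<le> d \<Longrightarrow> {r \<in> carrier R. h r = \<zero>\<^bsub>S\<^esub>} \<subseteq> P i" "\<And>i. i < d \<Longrightarrow> P i \<subset> P (Suc i)"
      by blast
    have "primeideal (h ` P i) S" if "i \<le> d" for i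
      by (rule primeideal_image[OF h S surj P(1)[OF that]]) (use P(2)[OF that] in auto)
    moreover have "h ` P i \<subset> h ` P (Suc i)" if "i < d" for i
    proof -
      obtain r where r: "r \<in> P (Suc i)" "r \<notin> P i" using P(3)[OF \<open>i < d\<close>] by blast
      interpret Q: primeideal "P (Suc i)" R by (rule P(1)) (use that in simp)
      interpret P: primeideal "P i" R by (rule P(1)) (use that in simp)
      have "r \<in> carrier R" using r Q.a_Hcarr by simp
      then have "h r \<notin> h ` P i"
        using image_mem_iff[OF h P.is_ideal] P(2)[of i] that r by (simp add: subset_iff)
      then show ?thesis using r P(3)[OF \<open>i < d\<close>] by blast
    qed
    ultimately show ?L by (intro exI[of _ "\<lambda>i. h ` P i"]) blast
  qed
  then show ?thesis unfolding krull_dim_def by simp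
qed

lemma (in cring) genideal_subsetI:
  assumes "S \<subseteq> carrier R" "ideal J R" "S \<subseteq> J" shows "genideal R S \<subseteq> J"
  using genideal_minimal assms by blast

lemma (in cring) genideal_mono:
  assumes "S \<subseteq> T" "T \<subseteq> carrier R" shows "genideal R S \<subseteq> genideal R T"
  by (rule genideal_subsetI) (use assms genideal_ideal genideal_self in blast)+

lemma surj_quotient: "(+>\<^bsub>R\<^esub>) I ` carrier R = carrier (R Quot I)"
  by (auto simp: FactRing_def A_RCOSETS_def' a_r_coset_def)

lemma zero_Quot: "\<zero>\<^bsub>R Quot I\<^esub> = I"
  by (simp add: FactRing_def)

lemma (in cring) quotient_zero_iff:
  assumes "ideal I R" "r \<in> carrier R" shows "I +> r = I \<longleftrightarrow> r \<in> I"
proof -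
  interpret I: ideal I R by (rule assms)
  show ?thesis using assms(2) I.rcos_const_imp_mem a_rcos_zero[OF assms(1)] by auto
qed

text \<open>The preimage of the ideal generated downstairs contains \<open>C \<union> F\<close>, and the image of the ideal
  generated upstairs is an ideal because the projection is surjective. Iterated quotients thus
  reduce to membership in ideals of \<open>R\<close>.\<close>

lemma (in cring) genideal_quotient_iff:
  assumes C: "C \<subseteq> carrier R" and F: "F \<subseteq> carrier R" and b: "b \<in> carrier R"
  defines "I \<equiv> genideal R C"
  shows "I +> b \<in> genideal (R Quot I) ((+>) I ` F) \<longleftrightarrow> b \<in> genideal R (C \<union> F)"
proof -
  have I: "ideal I R" unfolding I_def by (rule genideal_ideal[OF C])
  interpret I: ideal I R by (rule I)
  interpret Q: cring "R Quot I" by (rule I.quotient_is_cring[OF is_cring])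
  have h: "ring_hom_ring R (R Quot I) ((+>) I)" by (rule I.rcos_ring_hom_ring)
  interpret h: ring_hom_ring R "R Quot I" "(+>) I" by (rule h)
  let ?G = "genideal R (C \<union> F)" and ?H = "genideal (R Quot I) ((+>) I ` F)"
  have Fc: "(+>) I ` F \<subseteq> carrier (R Quot I)" using F by auto
  have G: "ideal ?G R" by (rule genideal_ideal) (use C F in auto)
  have H: "ideal ?H (R Quot I)" by (rule Q.genideal_ideal[OF Fc])
  have IG: "I \<subseteq> ?G" unfolding I_def by (rule genideal_mono) (use C F in auto)
  have ker: "r \<in> ?G" if "r \<in> carrier R" "I +> r = \<zero>\<^bsub>R Quot I\<^esub>" for r
    using that quotient_zero_iff[OF I] IG by (auto simp: zero_Quot)
  have "?G \<subseteq> {r \<in> carrier R. I +> r \<in> ?H}"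
  proof (rule genideal_subsetI)
    show "C \<union> F \<subseteq> carrier R" using C F by auto
    show "ideal {r \<in> carrier R. I +> r \<in> ?H} R" by (rule h.ideal_vimage[OF H])
    interpret H: ideal ?H "R Quot I" by (rule H)
    have "I +> c \<in> ?H" if "c \<in> C" for c
    proof -
      have "c \<in> I" unfolding I_def using genideal_self[OF C] that by auto
      then have "I +> c = \<zero>\<^bsub>R Quot I\<^esub>" using quotient_zero_iff[OF I] C that by (auto simp: zero_Quot)
      then show ?thesis using H.zero_closed by simp
    qed
    moreover have "I +> f \<in> ?H" if "f \<in> F" for f
      using Q.genideal_self[OF Fc] that by auto
    ultimately show "C \<union> F \<subseteq> {r \<in> carrier R. I +> r \<in> ?H}" using C F by auto
  qed
  moreover have "?H \<subseteq> (+>) I ` ?G"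
  proof (rule Q.genideal_subsetI[OF Fc])
    show "ideal ((+>) I ` ?G) (R Quot I)" by (rule ideal_image[OF h surj_quotient G])
    show "(+>) I ` F \<subseteq> (+>) I ` ?G" using genideal_self[of "C \<union> F"] C F by auto
  qed
  ultimately show ?thesis using image_mem_iff[OF h G ker b] b by auto
qed

context cring
begin

text \<open>Both the last dimension and each step of a regular sequence concern a quotient of \<open>R/I\<close>; composing
  the two projections makes it a quotient of \<open>R\<close>, where the calculations take place.\<close>
lemma double_quotient_hom:
  assumes C: "C \<subseteq> carrier R" and F: "F \<subseteq> carrier R"
  defines "I \<equiv> genideal R C"
  defines "J \<equiv> genideal (R Quot I) ((+>) I ` F)"
  defines "h \<equiv> \<lambda>r. J +>\<^bsub>R Quot I\<^esub> (I +> r)"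
  shows "cring (R Quot I)" "cring (R Quot I Quot J)" "ideal J (R Quot I)"
    and "ring_hom_ring R (R Quot I Quot J) h"
    and "h ` carrier R = carrier (R Quot I Quot J)"
    and "\<And>r. r \<in> carrier R \<Longrightarrow> h r = \<zero>\<^bsub>R Quot I Quot J\<^esub> \<longleftrightarrow> r \<in> genideal R (C \<union> F)"
proof -
  have I: "ideal I R" unfolding I_def by (rule genideal_ideal[OF C])
  interpret I: ideal I R by (rule I)
  show A: "cring (R Quot I)" by (rule I.quotient_is_cring[OF is_cring])
  interpret A: cring "R Quot I" by (rule A)
  have h1: "ring_hom_ring R (R Quot I) ((+>) I)" by (rule I.rcos_ring_hom_ring)
  interpret h1: ring_hom_ring R "R Quot I" "(+>) I" by (rule h1)
  show J: "ideal J (R Quot I)" unfolding J_def by (rule A.genideal_ideal) (use F in auto)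
  interpret J: ideal J "R Quot I" by (rule J)
  show Q: "cring (R Quot I Quot J)" by (rule J.quotient_is_cring[OF A])
  interpret Q: cring "R Quot I Quot J" by (rule Q)
  have h_comp: "h = (+>\<^bsub>R Quot I\<^esub>) J \<circ> (+>) I" by (auto simp: h_def)
  show "ring_hom_ring R (R Quot I Quot J) h"
    unfolding h_comp
    by (rule ring_hom_ringI2[OF ring_axioms Q.ring_axioms ring_hom_trans[OF I.rcos_ring_hom J.rcos_ring_hom]])
  show "h ` carrier R = carrier (R Quot I Quot J)"
    unfolding h_comp image_comp[symmetric] surj_quotient ..
  fix r assume r: "r \<in> carrier R"
  have "h r = \<zero>\<^bsub>R Quot I Quot J\<^esub> \<longleftrightarrow> I +> r \<in> J"
    unfolding h_def zero_Quot using A.quotient_zero_iff[OF J] r by simp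
  also have "\<dots> \<longleftrightarrow> r \<in> genideal R (C \<union> F)"
    unfolding J_def I_def by (rule genideal_quotient_iff[OF C F r])
  finally show "h r = \<zero>\<^bsub>R Quot I Quot J\<^esub> \<longleftrightarrow> r \<in> genideal R (C \<union> F)" .
qed

text \<open>Regularity in the quotient becomes cancellation modulo ideals of \<open>R\<close>.\<close>
lemma regular_sequence_quotientI:
  assumes C: "C \<subseteq> carrier R" and fs: "set fs \<subseteq> carrier R"
    and cancel: "\<And>i r. i < length fs \<Longrightarrow> r \<in> carrier R \<Longrightarrow>
      fs ! i \<otimes> r \<in> genideal R (C \<union> set (take i fs)) \<Longrightarrow> r \<in> genideal R (C \<union> set (take i fs))"
    and proper: "genideal R (C \<union> set fs) \<noteq> carrier R"
  shows "regular_sequence (R Quot genideal R C) (map ((+>) (genideal R C)) fs)"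
proof -
  define I where "I = genideal R C"
  have h1: "ring_hom_ring R (R Quot I) ((+>) I)"
    unfolding I_def by (rule ideal.rcos_ring_hom_ring[OF genideal_ideal[OF C]])
  interpret h1: ring_hom_ring R "R Quot I" "(+>) I" by (rule h1)
  show ?thesis
    unfolding regular_sequence_def Let_def I_def[symmetric]
  proof (intro conjI allI impI)
    show "set (map ((+>) I) fs) \<subseteq> carrier (R Quot I)" using fs by auto
    have "\<one> \<notin> genideal R (C \<union> set fs)"
    proof
      assume "\<one> \<in> genideal R (C \<union> set fs)"
      moreover have "ideal (genideal R (C \<union> set fs)) R" by (rule genideal_ideal) (use C fs in auto)
      ultimately show False using ideal.one_imp_carrier proper by blast
    qed
    then have "I +> \<one> \<notin> genideal (R Quot I) ((+>) I ` set fs)"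
      unfolding I_def using genideal_quotient_iff[OF C fs, of \<one>] by simp
    then show "genideal (R Quot I) (set (map ((+>) I) fs)) \<noteq> carrier (R Quot I)"
      using h1.hom_closed[OF one_closed] by auto
    fix i assume "i < length (map ((+>) I) fs)"
    then have i: "i < length fs" by simp
    define F where "F = set (take i fs)"
    have F: "F \<subseteq> carrier R" using fs set_take_subset unfolding F_def by fastforce
    define J where "J = genideal (R Quot I) ((+>) I ` F)"
    define h where "h r = J +>\<^bsub>R Quot I\<^esub> (I +> r)" for r
    note hom = double_quotient_hom[OF C F, folded I_def, folded J_def, folded h_def]
    interpret h: ring_hom_ring R "R Quot I Quot J" h by (rule hom(4))
    have fi: "fs ! i \<in> carrier R" using fs i by auto
    have "nonzerodivisor (R Quot I Quot J) (h (fs ! i))"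
      unfolding nonzerodivisor_def
    proof (intro conjI ballI impI)
      show "h (fs ! i) \<in> carrier (R Quot I Quot J)" using fi by simp
      fix b assume "b \<in> carrier (R Quot I Quot J)"
        and zero: "h (fs ! i) \<otimes>\<^bsub>R Quot I Quot J\<^esub> b = \<zero>\<^bsub>R Quot I Quot J\<^esub>"
      then obtain r where r: "r \<in> carrier R" "b = h r" using hom(5) by blast
      have "h (fs ! i \<otimes> r) = \<zero>\<^bsub>R Quot I Quot J\<^esub>" using zero r fi by simp
      then have "fs ! i \<otimes> r \<in> genideal R (C \<union> F)" using hom(6) fi r by blast
      then have "r \<in> genideal R (C \<union> F)" using cancel[OF i r(1)] by (simp add: F_def)
      then show "b = \<zero>\<^bsub>R Quot I Quot J\<^esub>" using hom(6) r by blast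
    qed
    moreover have "set (take i (map ((+>) I) fs)) = (+>) I ` F"
      by (simp add: F_def take_map)
    ultimately show "nonzerodivisor (R Quot I Quot genideal (R Quot I) (set (take i (map ((+>) I) fs))))
        (genideal (R Quot I) (set (take i (map ((+>) I) fs))) +>\<^bsub>R Quot I\<^esub> map ((+>) I) fs ! i)"
      using i by (simp add: J_def h_def)
  qed
qed

end

section \<open>Polynomials, linear extensions and substitutions\<close>

abbreviation monomial :: "('v \<Rightarrow>\<^sub>0 nat) \<Rightarrow> ('v, 'k::comm_ring_1) mpoly" where
  "monomial m \<equiv> Poly_Mapping.single m 1"

abbreviation scalar :: "'k \<Rightarrow> ('v, 'k::comm_ring_1) mpoly" where
  "scalar c \<equiv> Poly_Mapping.single 0 c"

lemma single_eq_scalar_monomial: "Poly_Mapping.single m c = scalar c * monomial m"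
  by (simp add: mult_single)

lemma monomial_add: "monomial (a + b) = monomial a * monomial b"
  by (simp add: mult_single)

lemma mpoly_induct [case_names single add]:
  fixes p :: "('v, 'k::comm_ring_1) mpoly"
  assumes "\<And>m c. P (Poly_Mapping.single m c)" and "\<And>p q. P p \<Longrightarrow> P q \<Longrightarrow> P (p + q)"
  shows "P p"
proof (induction p rule: update_induct)
  case const
  show ?case using assms(1)[of 0 0] by simp
next
  case (update f a b)
  have "Poly_Mapping.update a b f = f + Poly_Mapping.single a b"
  proof (rule poly_mapping_eqI)
    fix k show "Poly_Mapping.lookup (Poly_Mapping.update a b f) k
      = Poly_Mapping.lookup (f + Poly_Mapping.single a b) k"
      using update(1) by (auto simp: lookup_update lookup_add lookup_single when_def in_keys_iff)
  qed
  then show ?case using assms update by metis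
qed

text \<open>Reduction modulo the quadratics and substitution of polynomials for variables are both given by
  their values on monomials; this is the common extension to polynomials.\<close>
definition linear_extension ::
    "(('v \<Rightarrow>\<^sub>0 nat) \<Rightarrow> ('w, 'k::comm_ring_1) mpoly) \<Rightarrow> ('v, 'k) mpoly \<Rightarrow> ('w, 'k) mpoly" where
  "linear_extension f p = (\<Sum>m\<in>Poly_Mapping.keys p. scalar (Poly_Mapping.lookup p m) * f m)"

lemma linear_extension_superset:
  assumes "finite A" "Poly_Mapping.keys p \<subseteq> A"
  shows "linear_extension f p = (\<Sum>m\<in>A. scalar (Poly_Mapping.lookup p m) * f m)"
  unfolding linear_extension_def
  by (rule sum.mono_neutral_left) (use assms in \<open>auto simp: in_keys_iff\<close>)

lemma linear_extension_single [simp]: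
  "linear_extension f (Poly_Mapping.single m c) = scalar c * f m"
  by (simp add: linear_extension_def)

lemma linear_extension_add:
  "linear_extension f (p + q) = linear_extension f p + linear_extension f q"
proof -
  let ?A = "Poly_Mapping.keys p \<union> Poly_Mapping.keys q"
  have "linear_extension f (p + q)
    = (\<Sum>m\<in>?A. scalar (Poly_Mapping.lookup (p + q) m) * f m)"
    by (rule linear_extension_superset) (use Poly_Mapping.keys_add[of p q] in auto)
  also have "\<dots> = (\<Sum>m\<in>?A. scalar (Poly_Mapping.lookup p m) * f m)
      + (\<Sum>m\<in>?A. scalar (Poly_Mapping.lookup q m) * f m)"
    by (simp add: lookup_add single_add algebra_simps sum.distrib)
  also have "\<dots> = linear_extension f p + linear_extension f q"
    by (simp add: linear_extension_superset[of ?A])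
  finally show ?thesis .
qed

lemma linear_extension_zero [simp]: "linear_extension f 0 = 0"
  by (simp add: linear_extension_def)

lemma linear_extension_uminus: "linear_extension f (- p) = - linear_extension f p"
  using linear_extension_add[of f p "- p"] by (simp add: eq_neg_iff_add_eq_0 add.commute)

lemma linear_extension_diff:
  "linear_extension f (p - q) = linear_extension f p - linear_extension f q"
  using linear_extension_add[of f p "- q"] by (simp add: linear_extension_uminus)

lemma linear_extension_sum:
  "linear_extension f (sum g A) = (\<Sum>a\<in>A. linear_extension f (g a))"
  by (induction A rule: infinite_finite_induct) (auto simp: linear_extension_add)

text \<open>The factor \<open>s\<close> is treated separately from \<open>p\<close> so that the rule covers ring homomorphisms, where
  the hypothesis holds for all monomials, as well as maps that are linear only over the polynomials
  in some of the variables.\<close>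
lemma linear_extension_mult_semilinear:
  assumes "\<And>m m'. m \<in> Poly_Mapping.keys s \<Longrightarrow> f (m + m') = h m * f m'"
  shows "linear_extension f (s * p) = linear_extension h s * linear_extension f p"
proof (induction p rule: mpoly_induct)
  case (single m' c)
  have "s = (\<Sum>m\<in>Poly_Mapping.keys s. Poly_Mapping.single m (Poly_Mapping.lookup s m))"
    by (rule poly_mapping_eqI) (auto simp: lookup_sum lookup_single when_def in_keys_iff)
  then have "s * Poly_Mapping.single m' c = (\<Sum>m\<in>Poly_Mapping.keys s.
      Poly_Mapping.single m (Poly_Mapping.lookup s m)) * Poly_Mapping.single m' c"
    by simp
  also have "\<dots> = (\<Sum>m\<in>Poly_Mapping.keys s.
      Poly_Mapping.single (m + m') (Poly_Mapping.lookup s m * c))"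
    by (simp add: sum_distrib_right mult_single)
  finally have "s * Poly_Mapping.single m' c = (\<Sum>m\<in>Poly_Mapping.keys s.
      Poly_Mapping.single (m + m') (Poly_Mapping.lookup s m * c))" .
  then have "linear_extension f (s * Poly_Mapping.single m' c) =
    (\<Sum>m\<in>Poly_Mapping.keys s. scalar (Poly_Mapping.lookup s m * c) * f (m + m'))"
    by (simp add: linear_extension_sum)
  also have "\<dots> = (\<Sum>m\<in>Poly_Mapping.keys s.
      scalar (Poly_Mapping.lookup s m) * h m * (scalar c * f m'))"
  proof (rule sum.cong)
    fix m assume "m \<in> Poly_Mapping.keys s"
    then have 1: "f (m + m') = h m * f m'" by (rule assms)
    have 2: "scalar (Poly_Mapping.lookup s m * c) = scalar (Poly_Mapping.lookup s m) * scalar c"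
      by (simp add: mult_single)
    show "scalar (Poly_Mapping.lookup s m * c) * f (m + m') =
      scalar (Poly_Mapping.lookup s m) * h m * (scalar c * f m')"
      unfolding 1 2 by (simp only: mult_ac)
  qed simp
  finally show ?case by (simp add: linear_extension_def sum_distrib_right)
next
  case (add p q)
  then show ?case by (simp add: linear_extension_add distrib_left)
qed

lemma linear_extension_monomial [simp]: "linear_extension monomial p = p"
  by (induction p rule: mpoly_induct) (auto simp: linear_extension_add mult_single)

definition power_product ::
    "('v \<Rightarrow> ('w, 'k::comm_ring_1) mpoly) \<Rightarrow> ('v \<Rightarrow>\<^sub>0 nat) \<Rightarrow> ('w, 'k) mpoly" where
  "power_product g m = (\<Prod>v\<in>Poly_Mapping.keys m. g v ^ Poly_Mapping.lookup m v)"

lemma power_product_superset: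
  assumes "finite A" "Poly_Mapping.keys m \<subseteq> A"
  shows "power_product g m = (\<Prod>v\<in>A. g v ^ Poly_Mapping.lookup m v)"
  unfolding power_product_def
  by (rule prod.mono_neutral_left) (use assms in \<open>auto simp: in_keys_iff\<close>)

lemma power_product_add: "power_product g (a + b) = power_product g a * power_product g b"
proof -
  let ?A = "Poly_Mapping.keys a \<union> Poly_Mapping.keys b"
  have "power_product g (a + b) = (\<Prod>v\<in>?A. g v ^ Poly_Mapping.lookup (a + b) v)"
    by (rule power_product_superset) (use Poly_Mapping.keys_add[of a b] in auto)
  also have "\<dots> = power_product g a * power_product g b"
    by (simp add: power_product_superset[of ?A] lookup_add power_add prod.distrib)
  finally show ?thesis .
qed

definition subst ::
    "('v \<Rightarrow> ('w, 'k::comm_ring_1) mpoly) \<Rightarrow> ('v, 'k) mpoly \<Rightarrow> ('w, 'k) mpoly" where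
  "subst g = linear_extension (power_product g)"

lemma subst_add [simp]: "subst g (p + q) = subst g p + subst g q"
  and subst_diff [simp]: "subst g (p - q) = subst g p - subst g q"
  and subst_uminus [simp]: "subst g (- p) = - subst g p"
  and subst_zero [simp]: "subst g 0 = 0"
  and subst_sum: "subst g (sum F A) = (\<Sum>a\<in>A. subst g (F a))"
  by (simp_all add: subst_def linear_extension_add linear_extension_diff
    linear_extension_uminus linear_extension_sum)

lemma subst_mult [simp]: "subst g (p * q) = subst g p * subst g q"
  unfolding subst_def by (rule linear_extension_mult_semilinear) (rule power_product_add)

lemma power_product_zero [simp]: "power_product g 0 = 1"
  by (simp add: power_product_def)

lemma subst_scalar [simp]: "subst g (scalar c) = scalar c"
  by (simp add: subst_def)

lemma subst_one [simp]: "subst g 1 = 1"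
  using subst_scalar[of g 1] by simp

lemma subst_power [simp]: "subst g (p ^ n) = subst g p ^ n"
  by (induction n) auto

lemma subst_prod: "subst g (prod F A) = (\<Prod>a\<in>A. subst g (F a))"
  by (induction A rule: infinite_finite_induct) auto

lemma subst_var [simp]: "subst g (mpoly_var v) = g v"
  by (simp add: subst_def mpoly_var_def power_product_def)

lemma power_product_mpoly_var: "power_product mpoly_var m = monomial m"
proof (induction m rule: update_induct)
  case const
  show ?case by simp
next
  case (update m v k)
  have eq: "Poly_Mapping.update v k m = m + Poly_Mapping.single v k"
  proof (rule poly_mapping_eqI)
    fix w show "Poly_Mapping.lookup (Poly_Mapping.update v k m) w
      = Poly_Mapping.lookup (m + Poly_Mapping.single v k) w"
      using update(1) by (auto simp: lookup_update lookup_add lookup_single when_def in_keys_iff)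
  qed
  have "power_product mpoly_var (Poly_Mapping.single v k) =
      (monomial (Poly_Mapping.single v k) :: ('a, 'b) mpoly)" for v k
  proof -
    have "mpoly_var v ^ k = (monomial (Poly_Mapping.single v k) :: ('a, 'b) mpoly)"
      by (induction k) (auto simp: mpoly_var_def mult_single single_add[symmetric])
    then show ?thesis by (simp add: power_product_def)
  qed
  then show ?case using update by (simp add: eq power_product_add monomial_add)
qed

lemma subst_mpoly_var [simp]: "subst mpoly_var p = p"
  by (simp add: subst_def power_product_mpoly_var[abs_def])

lemma subst_subst: "subst g (subst h p) = subst (\<lambda>v. subst g (h v)) p"
proof (induction p rule: mpoly_induct)
  case (single m c)
  then show ?case
    by (simp add: subst_def[of h] subst_def[of "\<lambda>v. subst g (h v)"])
      (simp add: power_product_def subst_prod)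
qed simp

abbreviation polys :: "'v set \<Rightarrow> ('v, 'k::comm_ring_1) mpoly set" where
  "polys V \<equiv> carrier (mpoly_ring V)"

lemma polys_iff: "p \<in> polys V \<longleftrightarrow> (\<forall>m\<in>Poly_Mapping.keys p. Poly_Mapping.keys m \<subseteq> V)"
  by (simp add: mpoly_ring_def)

lemma mpoly_ring_simps [simp]:
  "(\<otimes>\<^bsub>mpoly_ring V\<^esub>) = (*)" "(\<oplus>\<^bsub>mpoly_ring V\<^esub>) = (+)"
  "\<zero>\<^bsub>mpoly_ring V\<^esub> = 0" "\<one>\<^bsub>mpoly_ring V\<^esub> = 1"
  by (auto simp: mpoly_ring_def)

lemma polys_mult: "p \<in> polys V \<Longrightarrow> q \<in> polys V \<Longrightarrow> p * q \<in> polys V"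
  using cring.cring_simprules(5)[OF cring_mpoly_ring, of p V q] by simp

lemma polys_add: "p \<in> polys V \<Longrightarrow> q \<in> polys V \<Longrightarrow> p + q \<in> polys V"
  using cring.cring_simprules(1)[OF cring_mpoly_ring, of p V q] by simp

lemma polys_uminus: "p \<in> polys V \<Longrightarrow> - p \<in> polys V"
  by (simp add: polys_iff)

lemma polys_diff: "p \<in> polys V \<Longrightarrow> q \<in> polys V \<Longrightarrow> p - q \<in> polys V"
  using polys_add[of p V "- q"] polys_uminus[of q V] by simp

lemma polys_scalar [simp]: "scalar c \<in> polys V" by (simp add: polys_iff)
lemma polys_zero [simp]: "0 \<in> polys V" by (simp add: polys_iff)
lemma polys_one [simp]: "1 \<in> polys V" by (simp add: polys_iff)

lemma polys_var [simp]: "v \<in> V \<Longrightarrow> mpoly_var v \<in> polys V"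
  by (simp add: polys_iff mpoly_var_def)

lemma polys_mono: "p \<in> polys V \<Longrightarrow> V \<subseteq> W \<Longrightarrow> p \<in> polys W"
  by (auto simp: polys_iff)

lemma polys_sum: "(\<And>a. a \<in> A \<Longrightarrow> F a \<in> polys V) \<Longrightarrow> sum F A \<in> polys V"
  by (induction A rule: infinite_finite_induct) (auto intro: polys_add)

lemma polys_prod: "(\<And>a. a \<in> A \<Longrightarrow> F a \<in> polys V) \<Longrightarrow> prod F A \<in> polys V"
  by (induction A rule: infinite_finite_induct) (auto intro: polys_mult)

lemma polys_power: "p \<in> polys V \<Longrightarrow> p ^ n \<in> polys V"
  by (induction n) (auto intro: polys_mult)

lemma polys_subst:
  assumes "p \<in> polys V" "\<And>v. v \<in> V \<Longrightarrow> g v \<in> polys W"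
  shows "subst g p \<in> polys W"
  unfolding subst_def linear_extension_def power_product_def
  by (rule polys_sum, rule polys_mult, simp, rule polys_prod, rule polys_power)
    (use assms in \<open>auto simp: polys_iff[of p]\<close>)

lemma ideal_polysI:
  fixes J :: "('v, 'k::comm_ring_1) mpoly set"
  assumes "J \<subseteq> polys V" "0 \<in> J" "\<And>p q. p \<in> J \<Longrightarrow> q \<in> J \<Longrightarrow> p + q \<in> J"
    "\<And>r p. r \<in> polys V \<Longrightarrow> p \<in> J \<Longrightarrow> r * p \<in> J"
  shows "ideal J (mpoly_ring V)"
proof -
  interpret R: cring "mpoly_ring V :: ('v, 'k) mpoly ring" by (rule cring_mpoly_ring)
  have minus: "\<ominus>\<^bsub>mpoly_ring V\<^esub> p = - p" if "p \<in> polys V" for p :: "('v, 'k) mpoly"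
    by (rule R.minus_equality) (use that polys_uminus[of p V] in simp_all)
  show ?thesis
  proof (rule idealI)
    show "subgroup J (add_monoid (mpoly_ring V))"
    proof (rule R.add.subgroupI)
      fix a assume "a \<in> J"
      then have "- a \<in> J" using assms(4)[of "- 1" a] polys_uminus[of 1 V] by simp
      moreover have "a \<in> polys V" using \<open>a \<in> J\<close> assms(1) by auto
      ultimately show "\<ominus>\<^bsub>mpoly_ring V\<^esub> a \<in> J" using minus by simp
    qed (use assms in \<open>auto\<close>)
    fix a x :: "('v, 'k) mpoly" assume "a \<in> J" "x \<in> polys V"
    then show "x \<otimes>\<^bsub>mpoly_ring V\<^esub> a \<in> J" "a \<otimes>\<^bsub>mpoly_ring V\<^esub> x \<in> J"
      using assms(4)[of x a] by (simp_all add: mult.commute)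
  qed (rule R.ring_axioms)
qed

lemma ideal_polys_rules:
  fixes J :: "('v, 'k::comm_ring_1) mpoly set"
  assumes "ideal J (mpoly_ring V)"
  shows "J \<subseteq> polys V" "0 \<in> J" "\<And>p q. p \<in> J \<Longrightarrow> q \<in> J \<Longrightarrow> p + q \<in> J"
    "\<And>r p. r \<in> polys V \<Longrightarrow> p \<in> J \<Longrightarrow> r * p \<in> J" "\<And>p. p \<in> J \<Longrightarrow> - p \<in> J"
    "\<And>p q. p \<in> J \<Longrightarrow> q \<in> J \<Longrightarrow> p - q \<in> J"
proof -
  interpret J: ideal J "mpoly_ring V" by (rule assms)
  show 1: "J \<subseteq> polys V" by (rule J.a_subset)
  show "0 \<in> J" using additive_subgroup.zero_closed[OF J.additive_subgroup_axioms] by simp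
  show add: "p + q \<in> J" if "p \<in> J" "q \<in> J" for p q
    using additive_subgroup.a_closed[OF J.additive_subgroup_axioms that] by simp
  show mult: "r * p \<in> J" if "r \<in> polys V" "p \<in> J" for r p
    using J.I_l_closed[OF that(2,1)] by simp
  show uminus: "- p \<in> J" if "p \<in> J" for p
    using mult[of "- 1" p] that polys_uminus[of 1 V] by simp
  show "p - q \<in> J" if "p \<in> J" "q \<in> J" for p q
    using add[OF that(1) uminus[OF that(2)]] by simp
qed

lemma ideal_polys_sum:
  assumes "ideal J (mpoly_ring V)" "\<And>a. a \<in> A \<Longrightarrow> F a \<in> J" shows "sum F A \<in> J"
  using assms(2)
  by (induction A rule: infinite_finite_induct) (auto intro: ideal_polys_rules[OF assms(1)])

lemma primeideal_polys:
  assumes "primeideal P (mpoly_ring V)" "p \<in> polys V" "q \<in> polys V" "p * q \<in> P"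
  shows "p \<in> P \<or> q \<in> P"
  using primeideal.I_prime[OF assms(1-3)] assms(4) by simp

lemma ideal_polys_scalar:
  fixes P :: "('v, 'k::field) mpoly set"
  assumes "ideal P (mpoly_ring V)" "scalar c \<in> P" "c \<noteq> 0"
  shows "P = polys V"
proof
  show "P \<subseteq> polys V" by (rule ideal_polys_rules(1)[OF assms(1)])
  have "scalar (inverse c) * scalar c \<in> P"
    by (rule ideal_polys_rules(4)[OF assms(1) _ assms(2)]) simp
  then have "1 \<in> P" using assms(3) by (simp add: mult_single)
  then have "r * 1 \<in> P" if "r \<in> polys V" for r
    using ideal_polys_rules(4)[OF assms(1) that] by blast
  then show "polys V \<subseteq> P" by auto
qed

lemma genideal_subst:
  fixes g :: "'v \<Rightarrow> ('w, 'k::comm_ring_1) mpoly"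
  assumes g: "\<And>v. v \<in> V \<Longrightarrow> g v \<in> polys W" and S: "S \<subseteq> polys V"
    and p: "p \<in> genideal (mpoly_ring V) S"
  shows "subst g p \<in> genideal (mpoly_ring W) (subst g ` S)"
proof -
  interpret V: cring "mpoly_ring V :: ('v, 'k) mpoly ring" by (rule cring_mpoly_ring)
  interpret W: cring "mpoly_ring W :: ('w, 'k) mpoly ring" by (rule cring_mpoly_ring)
  let ?G = "genideal (mpoly_ring W) (subst g ` S)"
  have sub: "subst g ` S \<subseteq> polys W" by (rule image_subsetI, rule polys_subst[OF subsetD[OF S] g])
  note G = ideal_polys_rules[OF W.genideal_ideal[OF sub]]
  have "genideal (mpoly_ring V) S \<subseteq> {p \<in> polys V. subst g p \<in> ?G}"
  proof (rule V.genideal_subsetI[OF S])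
    show "ideal {p \<in> polys V. subst g p \<in> ?G} (mpoly_ring V)"
    proof (rule ideal_polysI)
      show "r * q \<in> {p \<in> polys V. subst g p \<in> ?G}"
        if "r \<in> polys V" "q \<in> {p \<in> polys V. subst g p \<in> ?G}" for r q
        using that G(4)[OF polys_subst[of r V g W], of "subst g q"] g by (auto intro: polys_mult)
    qed (use G(2,3) in \<open>auto intro: polys_add\<close>)
    show "S \<subseteq> {p \<in> polys V. subst g p \<in> ?G}" using S W.genideal_self[OF sub] by auto
  qed
  then show ?thesis using p by auto
qed

section \<open>Adjoining roots of monic quadratics to a polynomial ring\<close>

text \<open>The remainder of \<open>x\<^sup>e\<close> on division by \<open>x\<^sup>2 - a x - b\<close>.\<close>
fun reduced_power :: "'a::comm_ring_1 \<Rightarrow> 'a \<Rightarrow> 'a \<Rightarrow> nat \<Rightarrow> 'a" where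
  "reduced_power x a b 0 = 1"
| "reduced_power x a b (Suc 0) = x"
| "reduced_power x a b (Suc (Suc e)) = a * reduced_power x a b (Suc e) + b * reduced_power x a b e"

lemma reduced_power_congruent:
  assumes J: "ideal J (mpoly_ring V)" and q: "x\<^sup>2 - a * x - b \<in> J"
    and x: "x \<in> polys V" and a: "a \<in> polys V" and b: "b \<in> polys V"
  shows "x ^ e - reduced_power x a b e \<in> J"
proof (induction e rule: induct_nat_012)
  case (ge2 e)
  note rules = ideal_polys_rules[OF J]
  have "x ^ Suc (Suc e) - reduced_power x a b (Suc (Suc e)) =
    x ^ e * (x\<^sup>2 - a * x - b) + a * (x ^ Suc e - reduced_power x a b (Suc e))
      + b * (x ^ e - reduced_power x a b e)"
    by (simp add: algebra_simps power2_eq_square)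
  then show ?case using ge2 q polys_power[OF x, of e] a b by (auto intro!: rules(3,4))
qed (use ideal_polys_rules(2)[OF J] in simp_all)

lemma ideal_prod_congruent:
  fixes f g :: "'a \<Rightarrow> ('v, 'k::comm_ring_1) mpoly"
  assumes J: "ideal J (mpoly_ring V)"
    and "\<And>t. t \<in> T \<Longrightarrow> f t - g t \<in> J" "\<And>t. t \<in> T \<Longrightarrow> f t \<in> polys V" "\<And>t. t \<in> T \<Longrightarrow> g t \<in> polys V"
  shows "prod f T - prod g T \<in> J"
  using assms(2-)
proof (induction T rule: infinite_finite_induct)
  case (insert t T)
  note rules = ideal_polys_rules[OF J]
  have "prod f (insert t T) - prod g (insert t T)
    = f t * (prod f T - prod g T) + prod g T * (f t - g t)"
    using insert(1,2) by (simp add: algebra_simps)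
  moreover have "prod g T \<in> polys V" by (rule polys_prod) (use insert in auto)
  ultimately show ?case using insert by (auto intro!: rules(3,4))
qed (use ideal_polys_rules(2)[OF J] in simp_all)

text \<open>One notion of degree bound for two uses: the weight \<open>w\<close> of a monomial will be its total degree or
  its exponent in a single variable. Both are additive, which is all the estimates need.\<close>
definition weight_le :: "(('v \<Rightarrow>\<^sub>0 nat) \<Rightarrow> nat) \<Rightarrow> nat \<Rightarrow> ('v, 'k::comm_ring_1) mpoly \<Rightarrow> bool" where
  "weight_le w d p \<longleftrightarrow> (\<forall>m\<in>Poly_Mapping.keys p. w m \<le> d)"

lemma weight_le_add: "weight_le w d p \<Longrightarrow> weight_le w d q \<Longrightarrow> weight_le w d (p + q)"
  unfolding weight_le_def using Poly_Mapping.keys_add[of p q] by blast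

lemma weight_le_mono: "weight_le w d p \<Longrightarrow> d \<le> e \<Longrightarrow> weight_le w e p"
  unfolding weight_le_def using order_trans by blast

lemma weight_le_sum: "(\<And>a. a \<in> A \<Longrightarrow> weight_le w d (F a)) \<Longrightarrow> weight_le w d (sum F A)"
  by (induction A rule: infinite_finite_induct) (auto intro: weight_le_add simp: weight_le_def[of _ _ 0])

context
  fixes w :: "('v \<Rightarrow>\<^sub>0 nat) \<Rightarrow> nat"
  assumes additive: "\<And>m m'. w (m + m') = w m + w m'"
begin

lemma weight_le_mult: "weight_le w d p \<Longrightarrow> weight_le w e q \<Longrightarrow> weight_le w (d + e) (p * q)"
  unfolding weight_le_def
proof
  fix m assume *: "\<forall>m\<in>Poly_Mapping.keys p. w m \<le> d" "\<forall>m\<in>Poly_Mapping.keys q. w m \<le> e"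
    and "m \<in> Poly_Mapping.keys (p * q)"
  then obtain m1 m2 where "m1 \<in> Poly_Mapping.keys p" "m2 \<in> Poly_Mapping.keys q" "m = m1 + m2"
    using Poly_Mapping.keys_mult[of p q] by blast
  then show "w m \<le> d + e" using * by (simp add: additive add_mono)
qed

lemma weight_zero: "w 0 = 0"
  using additive[of 0 0] by simp

lemma weight_le_scalar: "weight_le w d (scalar c)"
  using weight_zero by (simp add: weight_le_def)

lemma weight_le_one: "weight_le w d 1"
  using weight_zero by (simp add: weight_le_def)

lemma weight_le_prod:
  "(\<And>a. a \<in> A \<Longrightarrow> weight_le w (d a) (F a)) \<Longrightarrow> weight_le w (sum d A) (prod F A)"
  by (induction A rule: infinite_finite_induct) (auto intro: weight_le_mult weight_le_one)

lemma weight_le_power: "weight_le w d p \<Longrightarrow> weight_le w (d * n) (p ^ n)"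
  by (induction n) (auto intro: weight_le_mult weight_le_one)

lemma weight_le_reduced_power:
  assumes "weight_le w d x" "weight_le w d a" "weight_le w (2 * d) b"
  shows "weight_le w (d * e) (reduced_power x a b e)"
proof (induction e rule: induct_nat_012)
  case (ge2 e)
  have "weight_le w (d + d * Suc e) (a * reduced_power x a b (Suc e))"
    "weight_le w (2 * d + d * e) (b * reduced_power x a b e)"
    using assms ge2 by (auto intro: weight_le_mult)
  moreover have "d + d * Suc e = d * Suc (Suc e)" "2 * d + d * e = d * Suc (Suc e)"
    by simp_all
  ultimately show ?case by (simp only: reduced_power.simps weight_le_add)
qed (use assms in \<open>simp_all add: weight_le_one\<close>)

text \<open>If neither coefficient involves a variable, all reduced powers are at most linear in it.\<close>

lemma weight_le_reduced_power_linear: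
  assumes "weight_le w d x" "weight_le w 0 a" "weight_le w 0 b"
  shows "weight_le w d (reduced_power x a b e)"
proof (induction e rule: induct_nat_012)
  case (ge2 e)
  have "weight_le w (0 + d) (a * reduced_power x a b (Suc e))"
    "weight_le w (0 + d) (b * reduced_power x a b e)"
    using assms ge2 by (blast intro: weight_le_mult)+
  then show ?case by (simp add: weight_le_add)
qed (use assms in \<open>simp_all add: weight_le_one\<close>)

end

lemma total_deg_superset:
  "finite A \<Longrightarrow> Poly_Mapping.keys m \<subseteq> A \<Longrightarrow> total_deg m = (\<Sum>v\<in>A. Poly_Mapping.lookup m v)"
  unfolding total_deg_def by (rule sum.mono_neutral_left) (auto simp: in_keys_iff)

lemma total_deg_add: "total_deg (a + b) = total_deg a + total_deg b"
proof -
  let ?A = "Poly_Mapping.keys a \<union> Poly_Mapping.keys b"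
  have "total_deg (a + b) = (\<Sum>v\<in>?A. Poly_Mapping.lookup (a + b) v)"
    by (rule total_deg_superset) (use Poly_Mapping.keys_add[of a b] in auto)
  also have "\<dots> = total_deg a + total_deg b"
    by (simp add: total_deg_superset[of ?A] lookup_add sum.distrib)
  finally show ?thesis .
qed

lemma total_deg_single: "total_deg (Poly_Mapping.single v e) = e"
  by (simp add: total_deg_def)

lemma weight_le_lookup_polys:
  assumes "p \<in> polys V" "v \<notin> V" shows "weight_le (\<lambda>m. Poly_Mapping.lookup m v) 0 p"
  using assms unfolding weight_le_def polys_iff
  by (metis le_zero_eq not_in_keys_iff_lookup_eq_zero subset_iff)

text \<open>The polynomial ring in the variables \<open>Z\<close>, extended by a root of \<open>t\<^sup>2 - a\<^bsub>t\<^esub> t - b\<^bsub>t\<^esub>\<close> for each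
  \<open>t \<in> T\<close>. With the bounds on the degrees of the coefficients, replacing \<open>t\<^sup>2\<close> by \<open>a\<^bsub>t\<^esub> t + b\<^bsub>t\<^esub>\<close> does not
  raise the total degree, as the dimension count requires.\<close>
locale quadratic_tower =
  fixes Z T :: "'v set" and a b :: "'v \<Rightarrow> ('v, 'k::field) mpoly"
  assumes finite_Z: "finite Z" and finite_T: "finite T" and disjoint: "Z \<inter> T = {}"
    and a_polys: "\<And>t. t \<in> T \<Longrightarrow> a t \<in> polys Z" and b_polys: "\<And>t. t \<in> T \<Longrightarrow> b t \<in> polys Z"
    and a_deg: "\<And>t. t \<in> T \<Longrightarrow> weight_le total_deg 1 (a t)"
    and b_deg: "\<And>t. t \<in> T \<Longrightarrow> weight_le total_deg 2 (b t)"
begin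

abbreviation V where "V \<equiv> Z \<union> T"

definition quadric :: "'v \<Rightarrow> ('v, 'k) mpoly" where
  "quadric t = (mpoly_var t)\<^sup>2 - a t * mpoly_var t - b t"

definition rpow :: "'v \<Rightarrow> nat \<Rightarrow> ('v, 'k) mpoly" where
  "rpow t = reduced_power (mpoly_var t) (a t) (b t)"

text \<open>The factor of a monomial that consists of the variables outside \<open>T\<close>.\<close>
definition coefficient_part :: "('v \<Rightarrow>\<^sub>0 nat) \<Rightarrow> ('v, 'k) mpoly" where
  "coefficient_part = power_product (\<lambda>v. if v \<in> T then 1 else mpoly_var v)"

definition normal_form :: "('v, 'k) mpoly \<Rightarrow> ('v, 'k) mpoly" where
  "normal_form = linear_extension
     (\<lambda>m. coefficient_part m * (\<Prod>t\<in>T. rpow t (Poly_Mapping.lookup m t)))"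

lemma normal_form_add: "normal_form (p + q) = normal_form p + normal_form q"
  and normal_form_diff: "normal_form (p - q) = normal_form p - normal_form q"
  and normal_form_zero [simp]: "normal_form 0 = 0"
  and normal_form_sum: "normal_form (sum F A) = (\<Sum>i\<in>A. normal_form (F i))"
  by (simp_all add: normal_form_def linear_extension_add linear_extension_diff
    linear_extension_sum)

lemma a_V: "t \<in> T \<Longrightarrow> a t \<in> polys V" and b_V: "t \<in> T \<Longrightarrow> b t \<in> polys V"
  using a_polys b_polys polys_mono by blast+

lemma quadric_polys: "t \<in> T \<Longrightarrow> quadric t \<in> polys V"
  unfolding quadric_def by (intro polys_diff polys_mult polys_power a_V b_V) auto

lemma rpow_polys: "t \<in> T \<Longrightarrow> rpow t e \<in> polys V"
  unfolding rpow_def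
  by (induction e rule: induct_nat_012) (auto intro!: polys_add polys_mult a_V b_V)

lemma coefficient_part_eq:
  "Poly_Mapping.keys m \<inter> T = {} \<Longrightarrow> coefficient_part m = monomial m"
  unfolding coefficient_part_def power_product_mpoly_var[symmetric]
  unfolding power_product_def by (rule prod.cong) auto

lemma coefficient_part_add:
  "coefficient_part (m + m') = coefficient_part m * coefficient_part m'"
  by (simp add: coefficient_part_def power_product_add)

text \<open>The exponents of the adjoined roots are untouched by multiplication with a coefficient,
  so reduction is linear over the polynomials in \<open>Z\<close>.\<close>

lemma normal_form_semilinear:
  assumes "s \<in> polys Z" shows "normal_form (s * p) = s * normal_form p"
proof -
  have "normal_form (s * p) = linear_extension monomial s * normal_form p"
    unfolding normal_form_def
  proof (rule linear_extension_mult_semilinear)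
    fix m m' assume "m \<in> Poly_Mapping.keys s"
    then have m: "Poly_Mapping.keys m \<inter> T = {}" using assms disjoint by (auto simp: polys_iff)
    then have "Poly_Mapping.lookup m t = 0" if "t \<in> T" for t
      using that by (auto simp: in_keys_iff)
    then show "coefficient_part (m + m') * (\<Prod>t\<in>T. rpow t (Poly_Mapping.lookup (m + m') t)) =
      monomial m * (coefficient_part m' * (\<Prod>t\<in>T. rpow t (Poly_Mapping.lookup m' t)))"
      by (simp add: coefficient_part_add coefficient_part_eq[OF m] lookup_add mult.assoc)
  qed
  then show ?thesis by simp
qed

text \<open>Multiplying a monomial by powers of \<open>t\<close> changes only the factor at \<open>t\<close> in its reduction, and the
  reduced powers satisfy the recurrence given by the quadratic.\<close>
lemma normal_form_quadric:
  assumes t: "t \<in> T" shows "normal_form (p * quadric t) = 0"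
proof (induction p rule: mpoly_induct)
  case (single m c)
  \<comment> \<open>The part of the reduction of \<open>m\<close> that does not see the exponent of \<open>t\<close>.\<close>
  define K where "K = coefficient_part m * (\<Prod>s\<in>T - {t}. rpow s (Poly_Mapping.lookup m s))"
  have step: "normal_form (monomial m * mpoly_var t ^ k) = K * rpow t (Poly_Mapping.lookup m t + k)" for k
  proof -
    have "mpoly_var t ^ k = (monomial (Poly_Mapping.single t k) :: ('v, 'k) mpoly)"
      using power_product_mpoly_var[of "Poly_Mapping.single t k", where ?'b = 'k]
      by (cases "k = 0") (simp_all add: power_product_def)
    then have "monomial m * mpoly_var t ^ k = (monomial (m + Poly_Mapping.single t k) :: ('v, 'k) mpoly)"
      by (simp add: monomial_add)
    then have "normal_form (monomial m * mpoly_var t ^ k) = coefficient_part (m + Poly_Mapping.single t k)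
      * (\<Prod>s\<in>T. rpow s (Poly_Mapping.lookup (m + Poly_Mapping.single t k) s))"
      by (simp add: normal_form_def)
    also have "coefficient_part (Poly_Mapping.single t k) = 1"
      using t by (simp add: coefficient_part_def power_product_def)
    then have "coefficient_part (m + Poly_Mapping.single t k) = coefficient_part m"
      by (simp add: coefficient_part_add)
    also have "(\<Prod>s\<in>T. rpow s (Poly_Mapping.lookup (m + Poly_Mapping.single t k) s)) =
      rpow t (Poly_Mapping.lookup m t + k) * (\<Prod>s\<in>T - {t}. rpow s (Poly_Mapping.lookup m s))"
      by (subst prod.remove[OF finite_T t]) (intro arg_cong2[where f = "(*)"] prod.cong,
          auto simp: lookup_add lookup_single when_def)
    finally show ?thesis by (simp add: K_def algebra_simps)
  qed
  have "monomial m * quadric t =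
      monomial m * mpoly_var t ^ 2 - a t * (monomial m * mpoly_var t ^ 1) - b t * (monomial m * mpoly_var t ^ 0)"
    by (simp add: quadric_def algebra_simps)
  then have "normal_form (monomial m * quadric t) = K * rpow t (Poly_Mapping.lookup m t + 2)
      - a t * (K * rpow t (Poly_Mapping.lookup m t + 1)) - b t * (K * rpow t (Poly_Mapping.lookup m t + 0))"
    by (simp only: normal_form_diff normal_form_semilinear a_polys[OF t] b_polys[OF t] step)
  also have "\<dots> = 0" by (simp add: rpow_def algebra_simps)
  finally have "normal_form (monomial m * quadric t) = 0" .
  then have "normal_form (scalar c * (monomial m * quadric t)) = 0"
    by (simp add: normal_form_semilinear)
  then show ?case by (simp add: single_eq_scalar_monomial[of m c] mult.assoc)
qed (simp add: distrib_right normal_form_add)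

lemma normal_form_congruent:
  assumes J: "ideal J (mpoly_ring V)" and q: "\<And>t. t \<in> T \<Longrightarrow> quadric t \<in> J" and p: "p \<in> polys V"
  shows "p - normal_form p \<in> J"
proof -
  note rules = ideal_polys_rules[OF J]
  let ?f = "\<lambda>m. coefficient_part m * (\<Prod>t\<in>T. rpow t (Poly_Mapping.lookup m t))"
  have mon: "monomial m - ?f m \<in> J" if m: "Poly_Mapping.keys m \<subseteq> V" for m
  proof -
    let ?A = "Poly_Mapping.keys m \<union> T"
    have fin: "finite ?A" using finite_T by simp
    have split: "(\<Prod>v\<in>?A. F v) = (\<Prod>v\<in>?A - T. F v) * (\<Prod>v\<in>T. F v)" for F :: "'v \<Rightarrow> ('v, 'k) mpoly"
      using prod.subset_diff[of T ?A F] fin by simp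
    have "coefficient_part m = (\<Prod>v\<in>?A. (if v \<in> T then 1 else mpoly_var v) ^ Poly_Mapping.lookup m v)"
      unfolding coefficient_part_def by (rule power_product_superset[OF fin]) simp
    also have "\<dots> = (\<Prod>v\<in>?A - T. mpoly_var v ^ Poly_Mapping.lookup m v)"
      unfolding split by simp
    finally have c: "coefficient_part m = (\<Prod>v\<in>?A - T. mpoly_var v ^ Poly_Mapping.lookup m v)" .
    have "monomial m = (\<Prod>v\<in>?A. (mpoly_var v :: ('v, 'k) mpoly) ^ Poly_Mapping.lookup m v)"
      unfolding power_product_mpoly_var[symmetric] by (rule power_product_superset[OF fin]) simp
    then have "monomial m - ?f m = coefficient_part m * ((\<Prod>t\<in>T. mpoly_var t ^ Poly_Mapping.lookup m t)
        - (\<Prod>t\<in>T. rpow t (Poly_Mapping.lookup m t)))"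
      unfolding split c by (simp add: algebra_simps)
    moreover have "coefficient_part m \<in> polys V"
      unfolding c by (intro polys_prod polys_power polys_var) (use m in auto)
    moreover have "(\<Prod>t\<in>T. mpoly_var t ^ Poly_Mapping.lookup m t)
        - (\<Prod>t\<in>T. rpow t (Poly_Mapping.lookup m t)) \<in> J"
      using q by (intro ideal_prod_congruent[OF J])
        (auto simp: rpow_def quadric_def intro!: reduced_power_congruent[OF J] a_V b_V polys_power
          rpow_polys[unfolded rpow_def])
    ultimately show ?thesis using rules(4) by simp
  qed
  have "p - normal_form p = linear_extension monomial p - normal_form p" by simp
  also have "\<dots> = (\<Sum>m\<in>Poly_Mapping.keys p. scalar (Poly_Mapping.lookup p m) * (monomial m - ?f m))"
    by (simp only: normal_form_def linear_extension_def sum_subtractf right_diff_distrib)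
  also have "\<dots> \<in> J"
    by (rule ideal_polys_sum[OF J], rule rules(4), simp, rule mon) (use p in \<open>auto simp: polys_iff\<close>)
  finally show ?thesis .
qed

text \<open>These two bounds confine the normal forms of bounded degree to finitely many monomials. Both add up
  the weights of the factors of a reduced monomial.\<close>
lemma normal_form_weights:
  assumes "p \<in> polys V"
  shows "weight_le total_deg d p \<Longrightarrow> weight_le total_deg d (normal_form p)"
    and "t \<in> T \<Longrightarrow> weight_le (\<lambda>m. Poly_Mapping.lookup m t) 1 (normal_form p)"
proof -
  assume d: "weight_le total_deg d p"
  show "weight_le total_deg d (normal_form p)"
    unfolding normal_form_def linear_extension_def
  proof (rule weight_le_sum)
    fix m assume m: "m \<in> Poly_Mapping.keys p"
    let ?l = "Poly_Mapping.lookup m"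
    have "weight_le total_deg (0 + ((\<Sum>v\<in>Poly_Mapping.keys m. if v \<in> T then 0 else ?l v) + (\<Sum>t\<in>T. ?l t)))
      (scalar (Poly_Mapping.lookup p m) * (coefficient_part m * (\<Prod>t\<in>T. rpow t (?l t))))"
      unfolding coefficient_part_def power_product_def
    proof (intro weight_le_mult total_deg_add weight_le_scalar weight_le_prod)
      fix v
      have var: "weight_le total_deg 1 (mpoly_var v :: ('v, 'k) mpoly)" for v
        by (simp add: weight_le_def mpoly_var_def total_deg_single)
      have one: "weight_le total_deg 0 (1 :: ('v, 'k) mpoly)"
        by (rule weight_le_one) (rule total_deg_add)
      show "weight_le total_deg (if v \<in> T then 0 else ?l v)
        ((if v \<in> T then 1 else mpoly_var v :: ('v, 'k) mpoly) ^ ?l v)"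
        using weight_le_power[OF total_deg_add var, of "?l v" v] one by simp
      show "weight_le total_deg (?l v) (rpow v (?l v))" if "v \<in> T"
        using weight_le_reduced_power[OF total_deg_add var, of "a v" "b v" "?l v"] a_deg[OF that] b_deg[OF that]
        by (simp add: rpow_def)
    qed
    also have "(\<Sum>v\<in>Poly_Mapping.keys m. if v \<in> T then 0 else ?l v) + (\<Sum>t\<in>T. ?l t) = total_deg m"
    proof -
      let ?A = "Poly_Mapping.keys m \<union> T"
      have fin: "finite ?A" using finite_T by simp
      have "(\<Sum>v\<in>Poly_Mapping.keys m. if v \<in> T then 0 else ?l v) = (\<Sum>v\<in>?A. if v \<in> T then 0 else ?l v)"
        by (rule sum.mono_neutral_left[OF fin]) auto
      also have "\<dots> = (\<Sum>v\<in>?A - T. ?l v)"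
        using sum.subset_diff[of T ?A "\<lambda>v. if v \<in> T then 0 else ?l v"] fin by simp
      also have "\<dots> + (\<Sum>t\<in>T. ?l t) = (\<Sum>v\<in>?A. ?l v)"
        using sum.subset_diff[of T ?A ?l] fin by simp
      also have "\<dots> = total_deg m" by (rule total_deg_superset[symmetric, OF fin]) simp
      finally show ?thesis .
    qed
    finally show "weight_le total_deg d
        (scalar (Poly_Mapping.lookup p m) * (coefficient_part m * (\<Prod>t\<in>T. rpow t (?l t))))"
      by (rule weight_le_mono) (use d m in \<open>simp add: weight_le_def\<close>)
  qed
next
  assume t: "t \<in> T"
  note add = lookup_add[of _ _ t]
  show "weight_le (\<lambda>m. Poly_Mapping.lookup m t) 1 (normal_form p)"
    unfolding normal_form_def linear_extension_def
  proof (rule weight_le_sum)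
    fix m assume m: "m \<in> Poly_Mapping.keys p"
    let ?l = "Poly_Mapping.lookup m"
    let ?w = "\<lambda>m. Poly_Mapping.lookup m t"
    have "weight_le ?w (0 + ((\<Sum>v\<in>Poly_Mapping.keys m. 0) + (\<Sum>v\<in>T. if v = t then 1 else 0)))
      (scalar (Poly_Mapping.lookup p m) * (coefficient_part m * (\<Prod>t\<in>T. rpow t (?l t))))"
      unfolding coefficient_part_def power_product_def
    proof (intro weight_le_mult add weight_le_scalar weight_le_prod)
      fix v
      have var: "weight_le ?w (if v = t then 1 else 0) (mpoly_var v :: ('v, 'k) mpoly)" for v
        by (simp add: weight_le_def mpoly_var_def lookup_single)
      have base: "weight_le ?w 0 (if v \<in> T then 1 else mpoly_var v :: ('v, 'k) mpoly)"
      proof (cases "v \<in> T")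
        case True
        then show ?thesis by (simp add: weight_le_one[OF add])
      next
        case False
        then have "v \<noteq> t" using t by auto
        then show ?thesis using False var[of v] by simp
      qed
      show "weight_le ?w 0 ((if v \<in> T then 1 else mpoly_var v :: ('v, 'k) mpoly) ^ ?l v)"
        using weight_le_power[OF add base, of "?l v"] by simp
      have "t \<notin> Z" using t disjoint by auto
      then show "weight_le ?w (if v = t then 1 else 0) (rpow v (?l v))" if "v \<in> T"
        unfolding rpow_def using a_polys[OF that] b_polys[OF that]
        by (intro weight_le_reduced_power_linear[OF add var] weight_le_lookup_polys)
    qed
    then show "weight_le ?w 1
        (scalar (Poly_Mapping.lookup p m) * (coefficient_part m * (\<Prod>t\<in>T. rpow t (?l t))))"
      by (rule weight_le_mono) (use finite_T t in simp)
  qed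
qed

end

section \<open>Regularity of the base variables\<close>

text \<open>The monomial ideal generated by the variables in \<open>F\<close>, described by the monomials that occur.\<close>
definition divisible_terms :: "'v set \<Rightarrow> ('v, 'k::comm_ring_1) mpoly set" where
  "divisible_terms F = {p. \<forall>m\<in>Poly_Mapping.keys p. Poly_Mapping.keys m \<inter> F \<noteq> {}}"

lemma divisible_terms_zero: "0 \<in> divisible_terms F"
  by (simp add: divisible_terms_def)

lemma divisible_terms_add:
  "p \<in> divisible_terms F \<Longrightarrow> q \<in> divisible_terms F \<Longrightarrow> p + q \<in> divisible_terms F"
  using Poly_Mapping.keys_add[of p q] unfolding divisible_terms_def by blast

lemma keys_add_nat:
  fixes a b :: "'v \<Rightarrow>\<^sub>0 nat"
  shows "Poly_Mapping.keys (a + b) = Poly_Mapping.keys a \<union> Poly_Mapping.keys b"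
  by (auto simp: in_keys_iff lookup_add)

lemma divisible_terms_var:
  assumes "v \<in> F" shows "mpoly_var v * p \<in> divisible_terms F"
  unfolding divisible_terms_def
proof (intro CollectI ballI)
  fix m assume "m \<in> Poly_Mapping.keys (mpoly_var v * p)"
  then obtain b where "m = Poly_Mapping.single v 1 + b"
    using Poly_Mapping.keys_mult[of "mpoly_var v" p] by (auto simp: mpoly_var_def split: if_splits)
  then show "Poly_Mapping.keys m \<inter> F \<noteq> {}" using assms by (auto simp: keys_add_nat)
qed

lemma lookup_monomial_mult:
  "Poly_Mapping.lookup (monomial a * p) (a + m) = Poly_Mapping.lookup p m"
  by (induction p rule: mpoly_induct)
    (simp_all add: mult_single lookup_single lookup_add distrib_left when_def)

lemma lookup_scalar_mult: "Poly_Mapping.lookup (scalar c * p) m = c * Poly_Mapping.lookup p m"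
  by (induction p rule: mpoly_induct)
    (simp_all add: mult_single lookup_single lookup_add distrib_left when_def)

lemma divisible_terms_cancel:
  assumes "v \<notin> F" and "mpoly_var v * p \<in> divisible_terms F"
  shows "p \<in> divisible_terms F"
  unfolding divisible_terms_def
proof (intro CollectI ballI)
  fix m assume "m \<in> Poly_Mapping.keys p"
  then have "Poly_Mapping.single v 1 + m \<in> Poly_Mapping.keys (mpoly_var v * p)"
    by (simp add: mpoly_var_def in_keys_iff lookup_monomial_mult)
  then have "Poly_Mapping.keys (Poly_Mapping.single v 1 + m) \<inter> F \<noteq> {}"
    using assms(2) unfolding divisible_terms_def by blast
  then show "Poly_Mapping.keys m \<inter> F \<noteq> {}" using assms(1) by (auto simp: keys_add_nat)
qed

lemma divisible_terms_in_ideal: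
  assumes J: "ideal J (mpoly_ring V)" and F: "mpoly_var ` F \<subseteq> J"
    and p: "p \<in> polys V" "p \<in> divisible_terms F"
  shows "p \<in> J"
proof -
  have "linear_extension monomial p \<in> J"
    unfolding linear_extension_def
  proof (rule ideal_polys_sum[OF J])
    fix m assume m: "m \<in> Poly_Mapping.keys p"
    then obtain v where v: "v \<in> Poly_Mapping.keys m" "v \<in> F"
      using p(2) by (auto simp: divisible_terms_def)
    define m' where "m' = m - Poly_Mapping.single v 1"
    have m': "m = Poly_Mapping.single v 1 + m'"
      using v by (intro poly_mapping_eqI)
        (auto simp: m'_def lookup_add lookup_minus lookup_single when_def in_keys_iff)
    have "scalar (Poly_Mapping.lookup p m) * monomial m =
      Poly_Mapping.single m' (Poly_Mapping.lookup p m) * mpoly_var v"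
      by (simp add: m' mpoly_var_def mult_single add.commute)
    moreover have "Poly_Mapping.keys m' \<subseteq> V"
      using m p(1) m' keys_add_nat[of "Poly_Mapping.single v 1" m'] by (auto simp: polys_iff)
    then have "Poly_Mapping.single m' (Poly_Mapping.lookup p m) \<in> polys V"
      by (simp add: polys_iff)
    ultimately show "scalar (Poly_Mapping.lookup p m) * monomial m \<in> J"
      using ideal_polys_rules(4)[OF J] F v by auto
  qed
  then show ?thesis by simp
qed

context quadratic_tower
begin

text \<open>Reduction is not multiplicative, so the polynomials whose normal form lies in the monomial ideal are
  not visibly an ideal. Demanding the same of all multiples makes them one.\<close>
lemma normal_form_divisible:
  assumes F: "F \<subseteq> Z" and p: "p \<in> genideal (mpoly_ring V) (quadric ` T \<union> mpoly_var ` F)"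
  shows "normal_form p \<in> divisible_terms F"
proof -
  interpret R: cring "mpoly_ring V :: ('v, 'k) mpoly ring" by (rule cring_mpoly_ring)
  let ?L = "{p \<in> polys V. \<forall>r. normal_form (r * p) \<in> divisible_terms F}"
  have sub: "quadric ` T \<union> mpoly_var ` F \<subseteq> polys V"
    using F quadric_polys by auto
  have "genideal (mpoly_ring V) (quadric ` T \<union> mpoly_var ` F) \<subseteq> ?L"
  proof (rule R.genideal_subsetI[OF sub])
    show "ideal ?L (mpoly_ring V)"
    proof (rule ideal_polysI)
      fix r p :: "('v, 'k) mpoly" assume r: "r \<in> polys V" and p: "p \<in> ?L"
      have "normal_form (s * (r * p)) \<in> divisible_terms F" for s
      proof -
        have "normal_form ((s * r) * p) \<in> divisible_terms F" using p by blast
        then show ?thesis by (simp only: mult.assoc)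
      qed
      then show "r * p \<in> ?L" using r p by (auto intro: polys_mult)
    qed (auto simp: distrib_left normal_form_add divisible_terms_zero
        intro: polys_add divisible_terms_add)
    have "normal_form (r * mpoly_var v) \<in> divisible_terms F" if "v \<in> F" for v r
    proof -
      have "normal_form (r * mpoly_var v) = mpoly_var v * normal_form r"
        using normal_form_semilinear[of "mpoly_var v" r] F that by (simp add: mult.commute subset_iff)
      then show ?thesis using divisible_terms_var[OF that] by simp
    qed
    then show "quadric ` T \<union> mpoly_var ` F \<subseteq> ?L"
      using sub by (auto simp: normal_form_quadric divisible_terms_zero)
  qed
  then have "normal_form (1 * p) \<in> divisible_terms F" using p by blast
  then show ?thesis by simp
qed

text \<open>A free module over the polynomial ring in \<open>Z\<close> inherits regularity of the variables of \<open>Z\<close>, in any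
  order: normal forms move the relation into the base ring, where \<open>z\<close> cancels from a monomial ideal
  in other variables.\<close>
theorem base_variable_cancel:
  assumes F: "F \<subseteq> Z" and z: "z \<in> Z" "z \<notin> F" and p: "p \<in> polys V"
    and zp: "mpoly_var z * p \<in> genideal (mpoly_ring V) (quadric ` T \<union> mpoly_var ` F)"
  shows "p \<in> genideal (mpoly_ring V) (quadric ` T \<union> mpoly_var ` F)" (is "p \<in> ?G")
proof -
  interpret R: cring "mpoly_ring V :: ('v, 'k) mpoly ring" by (rule cring_mpoly_ring)
  have sub: "quadric ` T \<union> mpoly_var ` F \<subseteq> polys V"
    using F quadric_polys by auto
  have G: "ideal ?G (mpoly_ring V)" by (rule R.genideal_ideal[OF sub])
  have gen: "quadric ` T \<union> mpoly_var ` F \<subseteq> ?G" by (rule R.genideal_self[OF sub])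
  have "mpoly_var z * normal_form p \<in> divisible_terms F"
    using normal_form_divisible[OF F zp] normal_form_semilinear[of "mpoly_var z"] z by simp
  then have "normal_form p \<in> divisible_terms F" using divisible_terms_cancel[OF z(2)] by blast
  moreover have diff: "p - normal_form p \<in> ?G"
    by (rule normal_form_congruent[OF G _ p]) (use gen in auto)
  then have "p - (p - normal_form p) \<in> polys V"
    using ideal_polys_rules(1)[OF G] p polys_diff by blast
  then have "normal_form p \<in> polys V" by simp
  ultimately have "normal_form p \<in> ?G"
    using divisible_terms_in_ideal[OF G] gen by auto
  then have "(p - normal_form p) + normal_form p \<in> ?G"
    by (rule ideal_polys_rules(3)[OF G diff])
  then show ?thesis by simp
qed

end

section \<open>The dimension of a tower of quadratic extensions\<close>

abbreviation list_power :: "'a::comm_monoid_mult list \<Rightarrow> nat list \<Rightarrow> 'a" where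
  "list_power xs e \<equiv> prod_list (map2 (^) xs e)"

lemma polys_list_power:
  "set xs \<subseteq> polys V \<Longrightarrow> list_power xs e \<in> polys V"
proof (induction xs arbitrary: e)
  case (Cons x xs)
  then show ?case by (cases e) (auto intro: polys_mult polys_power)
qed simp

text \<open>In a polynomial relation among the \<open>x\<^bsub>i\<^esub>\<close>, cancel the highest power of the first element that
  divides all terms, which is possible as this element is not in the prime \<open>P 0\<close>. Modulo \<open>P 1\<close>, which
  contains the first element, there remains a nontrivial relation among the other elements, to
  which induction applies for the shorter chain. A constant relation is impossible since primes are
  proper.\<close>
lemma prime_chain_algebraically_independent:
  fixes xs :: "('v, 'k::field) mpoly list" and P :: "nat \<Rightarrow> ('v, 'k) mpoly set"
  assumes "\<And>i. i \<le> length xs \<Longrightarrow> primeideal (P i) (mpoly_ring V)"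
    and "\<And>i. i < length xs \<Longrightarrow> P i \<subseteq> P (Suc i)"
    and "\<And>i. i < length xs \<Longrightarrow> xs ! i \<in> P (Suc i) \<and> xs ! i \<notin> P i"
    and "finite E" "E \<noteq> {}" "\<And>e. e \<in> E \<Longrightarrow> length e = length xs \<and> c e \<noteq> 0"
  shows "(\<Sum>e\<in>E. scalar (c e) * list_power xs e) \<notin> P 0"
  using assms
proof (induction xs arbitrary: P E c)
  case Nil
  then have "E = {[]}" by auto
  moreover have "c [] \<noteq> 0" using Nil \<open>E = {[]}\<close> by simp
  moreover have prime: "primeideal (P 0) (mpoly_ring V)" using Nil by simp
  then have "P 0 \<noteq> polys V" by (metis primeideal.I_notcarr)
  ultimately show ?case
    using ideal_polys_scalar[OF primeideal.axioms(1)[OF prime]] by auto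
next
  case (Cons x xs)
  have prime0: "primeideal (P 0) (mpoly_ring V)" and prime1: "primeideal (P 1) (mpoly_ring V)"
    using Cons.prems(1)[of 0] Cons.prems(1)[of 1] by auto
  note id0 = ideal_polys_rules[OF primeideal.axioms(1)[OF prime0]]
    and id1 = ideal_polys_rules[OF primeideal.axioms(1)[OF prime1]]
  have x: "x \<in> P 1" "x \<notin> P 0" using Cons.prems(3)[of 0] by auto
  have "y \<in> polys V" if "y \<in> set (x # xs)" for y
  proof -
    obtain i where i: "i < length (x # xs)" "y = (x # xs) ! i"
      using \<open>y \<in> set (x # xs)\<close> by (auto simp: in_set_conv_nth simp del: set_simps length_Cons)
    have "primeideal (P (Suc i)) (mpoly_ring V)" using Cons.prems(1)[of "Suc i"] i by simp
    then show ?thesis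
      using Cons.prems(3)[OF i(1)] i(2) ideal_polys_rules(1)[OF primeideal.axioms(1)] by blast
  qed
  then have xV: "x \<in> polys V" and xsV: "set xs \<subseteq> polys V" by auto
  \<comment> \<open>The exponent of \<open>x\<close> that can be cancelled; \<open>E'\<close> collects the terms that survive modulo \<open>x\<close>.\<close>
  define k where "k = Min (hd ` E)"
  define E' where "E' = {e \<in> E. hd e = k}"
  have k: "k \<le> hd e" if "e \<in> E" for e unfolding k_def using that Cons.prems(4) by simp
  have "k \<in> hd ` E" unfolding k_def using Cons.prems(4,5) by simp
  then have "E' \<noteq> {}" by (auto simp: E'_def)
  have Cons_e: "e = hd e # tl e" "length (tl e) = length xs" if "e \<in> E" for e
    using Cons.prems(6)[OF that] by (cases e; simp)+
  have tl_inj: "inj_on tl E'"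
  proof (rule inj_onI)
    fix e e' assume "e \<in> E'" "e' \<in> E'" "tl e = tl e'"
    then show "e = e'" using Cons_e(1)[of e] Cons_e(1)[of e'] by (simp add: E'_def)
  qed
  define Q where "Q = (\<Sum>e\<in>E. scalar (c e) * (x ^ (hd e - k) * list_power xs (tl e)))"
  have lp: "list_power (x # xs) e = x ^ k * (x ^ (hd e - k) * list_power xs (tl e))" if "e \<in> E" for e
  proof -
    have "list_power (x # xs) e = x ^ hd e * list_power xs (tl e)"
      by (subst Cons_e(1)[OF that]) simp
    also have "x ^ hd e = x ^ k * x ^ (hd e - k)"
      using k[OF that] by (simp add: power_add[symmetric])
    finally show ?thesis by (simp add: mult.assoc)
  qed
  have fact: "(\<Sum>e\<in>E. scalar (c e) * list_power (x # xs) e) = x ^ k * Q"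
    unfolding Q_def sum_distrib_left by (rule sum.cong) (use lp in \<open>simp_all add: mult.left_commute\<close>)
  show ?case
  proof
    assume "(\<Sum>e\<in>E. scalar (c e) * list_power (x # xs) e) \<in> P 0"
    then have "x ^ k * Q \<in> P 0" using fact by simp
    moreover have "Q \<in> P 0" if "x ^ j * Q \<in> P 0" for j
      using that
    proof (induction j)
      case (Suc j)
      have "Q \<in> polys V" unfolding Q_def
        by (intro polys_sum polys_mult polys_power polys_scalar xV polys_list_power xsV)
      then have "x ^ j * Q \<in> polys V" by (intro polys_mult polys_power xV)
      then show ?case
        using Suc primeideal_polys[OF prime0 xV, of "x ^ j * Q"] x(2) by (auto simp: mult.assoc)
    qed simp
    ultimately have "Q \<in> P 0" by blast
    then have "Q \<in> P 1" using Cons.prems(2)[of 0] by auto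
    moreover have "Q = (\<Sum>e\<in>E - E'. scalar (c e) * (x ^ (hd e - k) * list_power xs (tl e)))
      + (\<Sum>e\<in>E'. scalar (c e) * list_power xs (tl e))"
    proof -
      have "Q = (\<Sum>e\<in>E - E'. scalar (c e) * (x ^ (hd e - k) * list_power xs (tl e)))
        + (\<Sum>e\<in>E'. scalar (c e) * (x ^ (hd e - k) * list_power xs (tl e)))"
        unfolding Q_def by (rule sum.subset_diff) (use Cons.prems(4) in \<open>auto simp: E'_def\<close>)
      also have "(\<Sum>e\<in>E'. scalar (c e) * (x ^ (hd e - k) * list_power xs (tl e))) =
        (\<Sum>e\<in>E'. scalar (c e) * list_power xs (tl e))"
        by (rule sum.cong) (auto simp: E'_def)
      finally show ?thesis .
    qed
    moreover have "(\<Sum>e\<in>E - E'. scalar (c e) * (x ^ (hd e - k) * list_power xs (tl e))) \<in> P 1"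
    proof (rule ideal_polys_sum[OF primeideal.axioms(1)[OF prime1]])
      fix e assume e: "e \<in> E - E'"
      then have "k < hd e" using k[of e] by (auto simp: E'_def)
      then have "hd e - k = Suc (hd e - k - 1)" by simp
      then have "x ^ (hd e - k) = x * x ^ (hd e - k - 1)" by (metis power_Suc)
      then have "scalar (c e) * (x ^ (hd e - k) * list_power xs (tl e)) =
        (scalar (c e) * x ^ (hd e - k - 1) * list_power xs (tl e)) * x"
        by (simp only: mult_ac)
      moreover have "scalar (c e) * x ^ (hd e - k - 1) * list_power xs (tl e) \<in> polys V"
        by (intro polys_mult polys_power polys_scalar xV polys_list_power xsV)
      ultimately show "scalar (c e) * (x ^ (hd e - k) * list_power xs (tl e)) \<in> P 1"
        using id1(4) x(1) by simp
    qed
    ultimately have "(\<Sum>e\<in>E'. scalar (c e) * list_power xs (tl e)) \<in> P 1"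
      using id1(6) by fastforce
    also have "(\<Sum>e\<in>E'. scalar (c e) * list_power xs (tl e)) =
      (\<Sum>e\<in>tl ` E'. scalar (c (k # e)) * list_power xs e)"
      unfolding sum.reindex[OF tl_inj] o_def
    proof (rule sum.cong)
      fix e assume "e \<in> E'"
      then have "k # tl e = e" using Cons_e(1)[of e] by (simp add: E'_def)
      then show "scalar (c e) * list_power xs (tl e) = scalar (c (k # tl e)) * list_power xs (tl e)"
        by simp
    qed simp
    finally have "(\<Sum>e\<in>tl ` E'. scalar (c (k # e)) * list_power xs e) \<in> P (Suc 0)" by simp
    moreover have "(\<Sum>e\<in>tl ` E'. scalar (c (k # e)) * list_power xs e) \<notin> P (Suc 0)"
    proof (rule Cons.IH[of "\<lambda>i. P (Suc i)"])
      fix e assume "e \<in> tl ` E'"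
      then obtain e' where e': "e' \<in> E" "hd e' = k" "e = tl e'" by (auto simp: E'_def)
      then have "k # e = e'" using Cons_e(1)[of e'] by simp
      then show "length e = length xs \<and> c (k # e) \<noteq> 0"
        using Cons.prems(6)[of e'] Cons_e(2)[of e'] e' by simp
    next
      show "xs ! i \<in> P (Suc (Suc i)) \<and> xs ! i \<notin> P (Suc i)" if "i < length xs" for i
        using Cons.prems(3)[of "Suc i"] that by simp
      show "finite (tl ` E')" using Cons.prems(4) by (simp add: E'_def)
    qed (use Cons.prems(1,2) \<open>E' \<noteq> {}\<close> in auto)
    ultimately show False by blast
  qed
qed

text \<open>Gaussian elimination: more unknowns (\<open>E\<close>) than equations (\<open>B\<close>).\<close>
lemma homogeneous_system_nontrivial_solution:
  fixes a :: "'e \<Rightarrow> 'b \<Rightarrow> 'k::field"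
  assumes "finite B" "finite E" "card B < card E"
  shows "\<exists>c. (\<exists>e\<in>E. c e \<noteq> 0) \<and> (\<forall>b\<in>B. (\<Sum>e\<in>E. c e * a e b) = 0)"
  using assms
proof (induction B arbitrary: E a rule: finite_induct)
  case empty
  then have "E \<noteq> {}" by auto
  then show ?case by (intro exI[of _ "\<lambda>_. 1"]) auto
next
  case (insert b B)
  show ?case
  proof (cases "\<forall>e\<in>E. a e b = 0")
    case True
    have "card B < card E" using insert.prems insert.hyps by simp
    then obtain c where "\<exists>e\<in>E. c e \<noteq> 0" "\<forall>b\<in>B. (\<Sum>e\<in>E. c e * a e b) = 0"
      using insert.IH[OF insert.prems(1)] by blast
    then show ?thesis using True by (intro exI[of _ c]) auto
  next
    case False
    then obtain e0 where e0: "e0 \<in> E" "a e0 b \<noteq> 0" by blast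
    have "finite (E - {e0})" "card B < card (E - {e0})"
      using insert.prems insert.hyps e0(1) by simp_all
    from insert.IH[OF this, of "\<lambda>e b'. a e b' - a e b / a e0 b * a e0 b'"]
    obtain c where c: "\<exists>e\<in>E - {e0}. c e \<noteq> 0"
      "\<forall>b'\<in>B. (\<Sum>e\<in>E - {e0}. c e * (a e b' - a e b / a e0 b * a e0 b')) = 0"
      by blast
    \<comment> \<open>The value of the eliminated unknown that satisfies equation \<open>b\<close>.\<close>
    define s where "s = - (\<Sum>e\<in>E - {e0}. c e * (a e b / a e0 b))"
    define c' where "c' e = (if e = e0 then s else c e)" for e
    have sum_c': "(\<Sum>e\<in>E. c' e * a e b') =
      (\<Sum>e\<in>E - {e0}. c e * (a e b' - a e b / a e0 b * a e0 b'))" for b'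
    proof -
      have "(\<Sum>e\<in>E. c' e * a e b') = s * a e0 b' + (\<Sum>e\<in>E - {e0}. c e * a e b')"
        by (subst sum.remove[OF insert.prems(1) e0(1)]) (auto simp: c'_def intro!: sum.cong)
      also have "\<dots> = (\<Sum>e\<in>E - {e0}. c e * (a e b' - a e b / a e0 b * a e0 b'))"
        by (simp add: s_def sum_distrib_right right_diff_distrib sum_subtractf mult.assoc)
      finally show ?thesis .
    qed
    have "(\<Sum>e\<in>E. c' e * a e b') = 0" if "b' \<in> insert b B" for b'
      unfolding sum_c' using that c(2) e0(2) by auto
    moreover have "\<exists>e\<in>E. c' e \<noteq> 0" using c(1) by (auto simp: c'_def)
    ultimately show ?thesis by blast
  qed
qed

context quadratic_tower
begin

definition basis_monomials :: "nat \<Rightarrow> ('v \<Rightarrow>\<^sub>0 nat) set" where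
  "basis_monomials d = {m. Poly_Mapping.keys m \<subseteq> V \<and> total_deg m \<le> d \<and>
     (\<forall>t\<in>T. Poly_Mapping.lookup m t \<le> 1)}"

text \<open>A monomial is determined by its exponents on \<open>Z\<close>, each at most \<open>d\<close>, and by the subset of \<open>T\<close>
  that divides it.\<close>
lemma basis_monomials_bound:
  "finite (basis_monomials d) \<and> card (basis_monomials d) \<le> 2 ^ card T * (d + 1) ^ card Z"
proof -
  let ?f = "\<lambda>m. (restrict (Poly_Mapping.lookup m) Z, {t \<in> T. Poly_Mapping.lookup m t = 1})"
  have inj: "inj_on ?f (basis_monomials d)"
  proof (rule inj_onI)
    fix m m' assume m: "m \<in> basis_monomials d" and m': "m' \<in> basis_monomials d" and eq: "?f m = ?f m'"
    show "m = m'"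
    proof (rule poly_mapping_eqI)
      fix v
      consider "v \<in> Z" | "v \<in> T" | "v \<notin> V" by blast
      then show "Poly_Mapping.lookup m v = Poly_Mapping.lookup m' v"
      proof cases
        case 1
        then show ?thesis using eq by (metis (no_types, lifting) Pair_inject restrict_apply')
      next
        case 2
        have "(Poly_Mapping.lookup m v = 1) = (Poly_Mapping.lookup m' v = 1)"
          using eq 2 by auto
        moreover have "Poly_Mapping.lookup m v \<le> 1" "Poly_Mapping.lookup m' v \<le> 1"
          using m m' 2 by (auto simp: basis_monomials_def)
        ultimately show ?thesis by linarith
      next
        case 3
        then have "v \<notin> Poly_Mapping.keys m" "v \<notin> Poly_Mapping.keys m'"
          using m m' by (auto simp: basis_monomials_def)
        then show ?thesis by (simp add: in_keys_iff)
      qed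
    qed
  qed
  have "Poly_Mapping.lookup m v \<le> d" if "total_deg m \<le> d" for m :: "'v \<Rightarrow>\<^sub>0 nat" and v
  proof (cases "v \<in> Poly_Mapping.keys m")
    case True
    then have "Poly_Mapping.lookup m v \<le> total_deg m"
      unfolding total_deg_def by (intro member_le_sum) auto
    then show ?thesis using that by simp
  qed (simp add: in_keys_iff)
  then have sub: "?f ` basis_monomials d \<subseteq> (Z \<rightarrow>\<^sub>E {..d}) \<times> Pow T"
    by (auto simp: basis_monomials_def)
  have fin: "finite ((Z \<rightarrow>\<^sub>E {..d}) \<times> Pow T)"
    using finite_Z finite_T by (auto intro: finite_PiE)
  have "card (basis_monomials d) \<le> card ((Z \<rightarrow>\<^sub>E {..d}) \<times> Pow T)"
    by (rule card_inj_on_le[OF inj sub fin])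
  also have "\<dots> = 2 ^ card T * (d + 1) ^ card Z"
    using finite_Z finite_T by (simp add: card_cartesian_product card_Pow card_funcsetE mult.commute)
  finally show ?thesis using inj_on_finite[OF inj sub fin] by simp
qed

lemma weight_le_list_power:
  assumes "\<And>x. x \<in> set xs \<Longrightarrow> weight_le total_deg d x" "\<And>n. n \<in> set e \<Longrightarrow> n \<le> N"
  shows "weight_le total_deg (d * N * length xs) (list_power xs e)"
  using assms
proof (induction xs arbitrary: e)
  case Nil
  show ?case by (simp add: weight_le_one[OF total_deg_add])
next
  case (Cons x xs)
  show ?case
  proof (cases e)
    case Nil
    then show ?thesis by (simp add: weight_le_one[OF total_deg_add])
  next
    case (Cons n ns)
    have "weight_le total_deg (d * n) (x ^ n)"
      using Cons.prems by (intro weight_le_power[OF total_deg_add]) simp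
    then have "weight_le total_deg (d * N) (x ^ n)"
      using Cons Cons.prems(2) by (auto elim!: weight_le_mono)
    moreover have "weight_le total_deg (d * N * length xs) (list_power xs ns)"
      using Cons Cons.IH[of ns] Cons.prems by simp
    ultimately have "weight_le total_deg (d * N + d * N * length xs) (x ^ n * list_power xs ns)"
      by (rule weight_le_mult[OF total_deg_add])
    then show ?thesis using Cons by simp
  qed
qed

text \<open>There are \<open>N\<^bsup>|Z| + 1\<^esup>\<close> power products of the given elements with exponents below \<open>N\<close>, but their
  normal forms lie in a space whose dimension grows only like \<open>N\<^bsup>|Z|\<^esup>\<close>. For large \<open>N\<close> some nontrivial
  linear combination has normal form zero.\<close>
lemma algebraic_dependence:
  assumes xs: "set xs \<subseteq> polys V" "length xs = Suc (card Z)"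
    and J: "ideal J (mpoly_ring V)" "\<And>t. t \<in> T \<Longrightarrow> quadric t \<in> J"
  shows "\<exists>E c. finite E \<and> E \<noteq> {} \<and> (\<forall>e\<in>E. length e = length xs \<and> c e \<noteq> (0 :: 'k)) \<and>
    (\<Sum>e\<in>E. scalar (c e) * list_power xs e) \<in> J"
proof -
  define d where "d = Max (insert 0 (total_deg ` (\<Union>x\<in>set xs. Poly_Mapping.keys x)))"
  have d: "weight_le total_deg d x" if "x \<in> set xs" for x
    unfolding weight_le_def d_def using that by (auto intro!: Max_ge)
  define r where "r = d * length xs + 1"
  \<comment> \<open>Just large enough that \<open>2\<^bsup>|T|\<^esup> (r N)\<^bsup>|Z|\<^esup> < N\<^bsup>|Z| + 1\<^esup>\<close>.\<close>
  define N where "N = 2 ^ card T * r ^ card Z + 1"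
  define E where "E = {e. set e \<subseteq> {..<N} \<and> length e = length xs}"
  define B where "B = basis_monomials (d * N * length xs)"
  have finE: "finite E" unfolding E_def by (rule finite_lists_length_eq) simp
  have cardE: "card E = N ^ Suc (card Z)"
    unfolding E_def using card_lists_length_eq[of "{..<N}" "length xs"] xs(2) by simp
  have B: "finite B" "card B \<le> 2 ^ card T * (d * N * length xs + 1) ^ card Z"
    unfolding B_def using basis_monomials_bound by auto
  have "d * N * length xs + 1 \<le> r * N"
    unfolding r_def N_def by (simp add: algebra_simps)
  then have "2 ^ card T * (d * N * length xs + 1) ^ card Z \<le> 2 ^ card T * (r * N) ^ card Z"
    by (intro mult_left_mono power_mono) auto
  also have "\<dots> < N * N ^ card Z"
    unfolding power_mult_distrib by (simp add: N_def)
  finally have "card B < card E" using B(2) cardE by simp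
  from homogeneous_system_nontrivial_solution[OF B(1) finE this,
      of "\<lambda>e m. Poly_Mapping.lookup (normal_form (list_power xs e)) m"]
  obtain c where c: "\<exists>e\<in>E. c e \<noteq> 0"
    "\<And>m. m \<in> B \<Longrightarrow> (\<Sum>e\<in>E. c e * Poly_Mapping.lookup (normal_form (list_power xs e)) m) = 0"
    by blast
  define E' where "E' = {e \<in> E. c e \<noteq> 0}"
  let ?S = "\<Sum>e\<in>E. scalar (c e) * list_power xs e"
  have S: "?S \<in> polys V"
    by (intro polys_sum polys_mult polys_scalar polys_list_power xs)
  have nf: "normal_form ?S = (\<Sum>e\<in>E. scalar (c e) * normal_form (list_power xs e))"
    by (simp add: normal_form_sum normal_form_semilinear)
  have "normal_form ?S = 0"
  proof (rule poly_mapping_eqI)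
    fix m
    have lookup: "Poly_Mapping.lookup (normal_form ?S) m
      = (\<Sum>e\<in>E. c e * Poly_Mapping.lookup (normal_form (list_power xs e)) m)"
      unfolding nf by (simp add: lookup_sum lookup_scalar_mult)
    show "Poly_Mapping.lookup (normal_form ?S) m = Poly_Mapping.lookup 0 m"
    proof (cases "m \<in> B")
      case True
      then show ?thesis using lookup c(2) by simp
    next
      case False
      have "Poly_Mapping.lookup (normal_form (list_power xs e)) m = 0" if "e \<in> E" for e
      proof (rule ccontr)
        assume "Poly_Mapping.lookup (normal_form (list_power xs e)) m \<noteq> 0"
        then have m: "m \<in> Poly_Mapping.keys (normal_form (list_power xs e))"
          by (simp add: in_keys_iff)
        have e: "list_power xs e \<in> polys V" by (rule polys_list_power[OF xs(1)])
        have "weight_le total_deg (d * N * length xs) (list_power xs e)"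
          by (rule weight_le_list_power) (use d that in \<open>auto simp: E_def\<close>)
        from normal_form_weights(1)[OF e this] have "total_deg m \<le> d * N * length xs"
          using m by (simp add: weight_le_def)
        moreover have "Poly_Mapping.lookup m t \<le> 1" if "t \<in> T" for t
          using normal_form_weights(2)[OF e that] m by (simp add: weight_le_def)
        moreover have "list_power xs e - normal_form (list_power xs e) \<in> J"
          by (rule normal_form_congruent[OF J e])
        then have "list_power xs e - (list_power xs e - normal_form (list_power xs e)) \<in> polys V"
          using ideal_polys_rules(1)[OF J(1)] e polys_diff by blast
        then have "Poly_Mapping.keys m \<subseteq> V" using m by (simp add: polys_iff)
        ultimately have "m \<in> B" by (simp add: B_def basis_monomials_def)
        then show False using False by blast
      qed
      then show ?thesis using lookup by simp
    qed
  qed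
  then have "?S \<in> J" using normal_form_congruent[OF J S] by simp
  also have "?S = (\<Sum>e\<in>E'. scalar (c e) * list_power xs e)"
    by (rule sum.mono_neutral_right[OF finE]) (auto simp: E'_def)
  finally have "(\<Sum>e\<in>E'. scalar (c e) * list_power xs e) \<in> J" .
  moreover have "finite E'" using finE by (simp add: E'_def)
  moreover have "E' \<noteq> {}" "\<forall>e\<in>E'. length e = length xs \<and> c e \<noteq> 0"
    using c(1) by (auto simp: E'_def E_def)
  ultimately show ?thesis by blast
qed

theorem prime_chain_length_le:
  assumes prime: "\<And>i. i \<le> d \<Longrightarrow> primeideal (P i) (mpoly_ring V)"
    and chain: "\<And>i. i < d \<Longrightarrow> P i \<subset> P (Suc i)"
    and quadrics: "\<And>t. t \<in> T \<Longrightarrow> quadric t \<in> P 0"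
  shows "d \<le> card Z"
proof (rule ccontr)
  assume "\<not> d \<le> card Z"
  then have le: "Suc (card Z) \<le> d" by simp
  have "\<exists>x. x \<in> P (Suc i) \<and> x \<notin> P i" if "i < d" for i using chain[OF that] by blast
  then obtain x where x: "\<And>i. i < d \<Longrightarrow> x i \<in> P (Suc i) \<and> x i \<notin> P i" by metis
  define xs where "xs = map x [0..<Suc (card Z)]"
  have nth: "xs ! i = x i" if "i < length xs" for i
    using that by (simp add: xs_def del: upt_Suc)
  have len: "length xs = Suc (card Z)" by (simp add: xs_def)
  have "x i \<in> polys V" if "i < d" for i
    using x[OF that] ideal_polys_rules(1)[OF primeideal.axioms(1)[OF prime[of "Suc i"]]] that by auto
  then have "set xs \<subseteq> polys V" using le by (auto simp: xs_def)
  from algebraic_dependence[OF this len primeideal.axioms(1)[OF prime[of 0]] quadrics]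
  obtain E c where E: "finite E" "E \<noteq> {}" "\<forall>e\<in>E. length e = length xs \<and> c e \<noteq> (0 :: 'k)"
    and mem: "(\<Sum>e\<in>E. scalar (c e) * list_power xs e) \<in> P 0" by blast
  have "(\<Sum>e\<in>E. scalar (c e) * list_power xs e) \<notin> P 0"
  proof (rule prime_chain_algebraically_independent[OF _ _ _ E(1,2)])
    fix i
    show "primeideal (P i) (mpoly_ring V)" if "i \<le> length xs"
      by (rule prime) (use that le len in simp)
    show "P i \<subseteq> P (Suc i)" if "i < length xs"
      using chain[of i] that le len by auto
    show "xs ! i \<in> P (Suc i) \<and> xs ! i \<notin> P i" if "i < length xs"
      using x[of i] nth[OF that] that le len by simp
  qed (use E(3) in blast)
  with mem show False by blast
qed

end

section \<open>Chains of primes from parametrizations\<close>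

text \<open>The variables of the target are numbered because a linear order on the variables orders the
  monomials, and comparing leading monomials shows that the target is a domain.\<close>
lemma primeideal_subst_kernel:
  fixes g :: "'v \<Rightarrow> (nat, 'k::field) mpoly"
  shows "primeideal {p \<in> polys V. subst g p = 0} (mpoly_ring V)"
proof (rule primeidealI[OF _ cring_mpoly_ring])
  show "ideal {p \<in> polys V. subst g p = 0} (mpoly_ring V)"
    by (rule ideal_polysI) (auto intro: polys_add polys_mult)
  have "1 \<notin> {p \<in> polys V. subst g p = 0}" by simp
  then show "polys V \<noteq> {p \<in> polys V. subst g p = 0}" using polys_one by blast
qed auto

text \<open>Specialization at \<open>1\<close> rather than at \<open>0\<close>: the parametrization below multiplies coordinates by
  parameters \<open>w\<^bsub>i\<^esub>\<close> that come first, and these factors have to disappear without killing the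
  coordinate.\<close>
definition specialize :: "nat \<Rightarrow> (nat, 'k::comm_ring_1) mpoly \<Rightarrow> (nat, 'k) mpoly" where
  "specialize k = subst (\<lambda>i. if i < k then 1 else mpoly_var i)"

text \<open>Specializing the parameters of a parametrized irreducible set one at a time yields ever smaller
  irreducible sets, that is, a chain of primes. The coordinate \<open>v k\<close> witnesses that step \<open>k\<close> is proper:
  on the slice it is the free parameter \<open>k\<close>, on the next slice it is constantly \<open>1\<close>.\<close>
lemma prime_chain_of_parametrization:
  fixes g :: "'v \<Rightarrow> (nat, 'k::field) mpoly"
  assumes V: "\<And>k. k < d \<Longrightarrow> v k \<in> V"
    and coordinate: "\<And>k. k < d \<Longrightarrow> specialize k (g (v k)) = mpoly_var k"
  defines "P \<equiv> \<lambda>k. {p \<in> polys V. specialize k (subst g p) = 0}"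
  shows "primeideal (P k) (mpoly_ring V)" and "k < d \<Longrightarrow> P k \<subset> P (Suc k)"
    and "{p \<in> polys V. subst g p = 0} \<subseteq> P k"
proof -
  show "primeideal (P k) (mpoly_ring V)"
    unfolding P_def specialize_def subst_subst by (rule primeideal_subst_kernel)
  show "{p \<in> polys V. subst g p = 0} \<subseteq> P k" by (auto simp: P_def specialize_def)
  assume k: "k < d"
  have step: "specialize (Suc k) q = specialize (Suc k) (specialize k q)" for q :: "(nat, 'k) mpoly"
    unfolding specialize_def subst_subst by (rule arg_cong[where f = "\<lambda>f. subst f q"]) auto
  have 1: "specialize j 1 = (1 :: (nat, 'k) mpoly)" for j by (simp add: specialize_def)
  have "specialize k (subst g (mpoly_var (v k) - 1)) = (mpoly_var k - 1 :: (nat, 'k) mpoly)"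
    using coordinate[OF k] by (simp add: specialize_def)
  moreover have "mpoly_var k \<noteq> (1 :: (nat, 'k) mpoly)"
  proof
    assume "mpoly_var k = (1 :: (nat, 'k) mpoly)"
    then have "subst (\<lambda>_. 0) (mpoly_var k) = subst (\<lambda>_. 0 :: (nat, 'k) mpoly) (1 :: (nat, 'k) mpoly)"
      by simp
    then show False by simp
  qed
  ultimately have "mpoly_var (v k) - 1 \<notin> P k" by (simp add: P_def)
  moreover have "specialize (Suc k) (subst g (mpoly_var (v k) - 1)) = 0"
    using coordinate[OF k] by (subst step) (simp add: specialize_def)
  then have "mpoly_var (v k) - 1 \<in> P (Suc k)"
    using V[OF k] by (simp add: P_def polys_diff)
  moreover have "P k \<subseteq> P (Suc k)"
  proof
    fix p assume p: "p \<in> P k"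
    then have "specialize (Suc k) (subst g p) = specialize (Suc k) 0"
      by (subst step) (simp add: P_def)
    then show "p \<in> P (Suc k)" using p by (simp add: P_def specialize_def)
  qed
  ultimately show "P k \<subset> P (Suc k)" by blast
qed

lemma subst_zero_eq:
  fixes p :: "('v, 'k::comm_ring_1) mpoly"
  shows "subst (\<lambda>_. 0 :: ('w, 'k) mpoly) p = scalar (Poly_Mapping.lookup p 0)"
proof (induction p rule: mpoly_induct)
  case (single m c)
  have "power_product (\<lambda>_. 0) m = (if m = 0 then 1 else 0 :: ('w, 'k) mpoly)"
  proof (cases "m = 0")
    case False
    then obtain v where "v \<in> Poly_Mapping.keys m" using keys_eq_empty by blast
    then have "power_product (\<lambda>_. 0) m = (0 :: ('w, 'k) mpoly)"
      unfolding power_product_def by (intro prod_zero bexI[of _ v]) (auto simp: in_keys_iff zero_power)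
    then show ?thesis using False by simp
  qed simp
  then show ?case by (simp add: subst_def lookup_single when_def)
qed (simp add: lookup_add single_add)

lemma scalar_eq_0_iff: "scalar c = 0 \<longleftrightarrow> c = 0"
  by (metis lookup_single_eq lookup_zero single_zero)

text \<open>A nonzero constant term of an element of \<open>P\<close> would itself lie in \<open>P\<close>, since the variables account for
  all other terms; but over a field it is a unit.\<close>
lemma prime_containing_variables:
  fixes P :: "('v, 'k::field) mpoly set"
  assumes P: "primeideal P (mpoly_ring V)" and var: "mpoly_var ` V \<subseteq> P"
  shows "P = {p \<in> polys V. Poly_Mapping.lookup p 0 = 0}"
proof -
  have id: "ideal P (mpoly_ring V)" by (rule primeideal.axioms(1)[OF P])
  have sub: "p \<in> P" if "p \<in> polys V" "Poly_Mapping.lookup p 0 = 0" for p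
  proof (rule divisible_terms_in_ideal[OF id var that(1)])
    show "p \<in> divisible_terms V"
      unfolding divisible_terms_def
    proof (intro CollectI ballI)
      fix m assume m: "m \<in> Poly_Mapping.keys p"
      then have "m \<noteq> 0" using that(2) by (auto simp: in_keys_iff)
      then have "Poly_Mapping.keys m \<noteq> {}" by simp
      then show "Poly_Mapping.keys m \<inter> V \<noteq> {}" using m that(1) unfolding polys_iff by blast
    qed
  qed
  moreover have "Poly_Mapping.lookup p 0 = 0" if p: "p \<in> P" for p
  proof (rule ccontr)
    assume c: "Poly_Mapping.lookup p 0 \<noteq> 0"
    have "p \<in> polys V" using p ideal_polys_rules(1)[OF id] by auto
    then have "p - scalar (Poly_Mapping.lookup p 0) \<in> P"
      by (intro sub polys_diff) (simp_all add: lookup_minus)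
    from ideal_polys_rules(6)[OF id p this] have "scalar (Poly_Mapping.lookup p 0) \<in> P" by simp
    from ideal_polys_scalar[OF id this c] show False using primeideal.I_notcarr[OF P] by simp
  qed
  ultimately show ?thesis using ideal_polys_rules(1)[OF id] by blast
qed

section \<open>The diagonal of the commutator\<close>

lemma commutator_diagonal:
  assumes "i < n"
  shows "commutator n $$ (i, i) = (\<Sum>j<n. xvar i j * yvar j i - yvar i j * xvar j i)"
  using assms by (simp add: commutator_def generic_X_def generic_Y_def scalar_prod_def
    sum_subtractf atLeast0LessThan)

definition diagonal_entries :: "nat \<Rightarrow> (entry, 'k::field) mpoly set" where
  "diagonal_entries n = {commutator n $$ (i, i) | i. i < n}"

lemma var_entries: "i < n \<Longrightarrow> j < n \<Longrightarrow> xvar i j \<in> polys (entries n)"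
  "i < n \<Longrightarrow> j < n \<Longrightarrow> yvar i j \<in> polys (entries n)"
  unfolding xvar_def yvar_def by (rule polys_var, force simp: entries_def)+

lemma diagonal_entries_polys: "diagonal_entries n \<subseteq> polys (entries n)"
  by (auto simp: diagonal_entries_def commutator_diagonal
    intro!: polys_sum polys_diff polys_mult var_entries)

lemma commutator_trace: "(\<Sum>i<n. commutator n $$ (i, i)) = 0"
proof -
  have "(\<Sum>i<n. commutator n $$ (i, i)) =
    (\<Sum>i<n. \<Sum>j<n. xvar i j * yvar j i) - (\<Sum>i<n. \<Sum>j<n. yvar i j * xvar j i)"
    by (simp add: commutator_diagonal sum_subtractf)
  also have "(\<Sum>i<n. \<Sum>j<n. yvar i j * xvar j i) = (\<Sum>i<n. \<Sum>j<n. xvar i j * yvar j i)"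
    by (subst sum.swap) (simp add: mult.commute)
  finally show ?thesis by simp
qed

lemma sum_lessThan_head: "0 < (n::nat) \<Longrightarrow> (\<Sum>i<n. F i) = F 0 + (\<Sum>i=1..<n. F i :: 'a::comm_monoid_add)"
  using sum.atLeast_Suc_lessThan[of 0 n F] by (simp add: atLeast0LessThan)

lemma commutator_corner:
  assumes "0 < n"
  shows "commutator n $$ (0, 0) = - (\<Sum>i=1..<n. commutator n $$ (i, i) :: (entry, 'k::field) mpoly)"
  using commutator_trace[of n, where ?'a = 'k]
  by (simp only: sum_lessThan_head[OF assms] eq_neg_iff_add_eq_0)

text \<open>Written with indices from \<open>0\<close>, the adjoined roots are the entries \<open>x\<^bsub>0i\<^esub>\<close> with \<open>i \<ge> 1\<close>.\<close>
definition roots :: "nat \<Rightarrow> entry set" where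
  "roots n = XE 0 ` {1..<n}"

definition base :: "nat \<Rightarrow> entry set" where
  "base n = entries n - roots n"

lemma roots_subset: "roots n \<subseteq> entries n"
  by (auto simp: roots_def entries_def)

lemma base_roots: "base n \<union> roots n = entries n"
  using roots_subset by (auto simp: base_def)

lemma entries_eq: "entries n = case_prod XE ` ({..<n} \<times> {..<n}) \<union> case_prod YE ` ({..<n} \<times> {..<n})"
  by (auto simp: entries_def image_iff)

lemma finite_entries: "finite (entries n)"
  by (simp add: entries_eq)

lemma card_entries: "card (entries n) = 2 * n\<^sup>2"
proof -
  have "card (case_prod XE ` ({..<n} \<times> {..<n})) = n * n"
    by (subst card_image) (auto simp: inj_on_def card_cartesian_product)
  moreover have "card (case_prod YE ` ({..<n} \<times> {..<n})) = n * n"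
    by (subst card_image) (auto simp: inj_on_def card_cartesian_product)
  ultimately show ?thesis
    unfolding entries_eq by (subst card_Un_disjoint) (auto simp: power2_eq_square)
qed

lemma card_roots: "card (roots n) = n - 1"
  unfolding roots_def by (subst card_image) (auto simp: inj_on_def)

lemma card_base: "card (base n) = 2 * n\<^sup>2 - (n - 1)"
  unfolding base_def using finite_subset[OF roots_subset finite_entries]
  by (subst card_Diff_subset) (auto simp: roots_subset card_entries card_roots)

text \<open>The substitution \<open>y\<^bsub>i0\<^esub> \<mapsto> x\<^bsub>0i\<^esub> - y\<^bsub>i0\<^esub>\<close>. It exchanges the variable \<open>y\<^bsub>i0\<^esub>\<close> with the parameter
  \<open>x\<^bsub>0i\<^esub> - y\<^bsub>i0\<^esub>\<close> and is its own inverse.\<close>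
definition swap_column :: "entry \<Rightarrow> (entry, 'k::field) mpoly" where
  "swap_column e = (case e of XE i j \<Rightarrow> xvar i j
     | YE i j \<Rightarrow> if j = 0 then xvar 0 i - yvar i 0 else yvar i j)"

abbreviation \<sigma> :: "(entry, 'k::field) mpoly \<Rightarrow> (entry, 'k) mpoly" where
  "\<sigma> \<equiv> subst swap_column"

lemma \<sigma>_xvar [simp]: "\<sigma> (xvar i j) = xvar i j"
  by (simp add: xvar_def swap_column_def)

lemma \<sigma>_yvar: "\<sigma> (yvar i j) = (if j = 0 then xvar 0 i - yvar i 0 else yvar i j)"
  by (simp add: yvar_def[of i j] swap_column_def)

lemma \<sigma>_involution [simp]:
  fixes p :: "(entry, 'k::field) mpoly"
  shows "\<sigma> (\<sigma> p) = p"
proof -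
  have "\<sigma> (swap_column e) = (mpoly_var e :: (entry, 'k) mpoly)" for e
    by (cases e) (auto simp: swap_column_def \<sigma>_yvar, auto simp: xvar_def yvar_def)
  then show ?thesis by (simp add: subst_subst)
qed

lemma swap_column_polys: "e \<in> entries n \<Longrightarrow> swap_column e \<in> polys (entries n)"
  by (cases e) (auto simp: swap_column_def entries_def[THEN eqset_imp_iff] intro!: polys_diff var_entries)

lemma \<sigma>_polys: "p \<in> polys (entries n) \<Longrightarrow> \<sigma> p \<in> polys (entries n)"
  by (rule polys_subst[OF _ swap_column_polys])

text \<open>The coefficients \<open>a\<close> and \<open>b\<close> of the quadratic satisfied by \<open>x\<^bsub>0i\<^esub>\<close>, with a default value at entries
  of \<open>Y\<close>, which are never roots.\<close>
definition root_linear :: "entry \<Rightarrow> (entry, 'k::field) mpoly" where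
  "root_linear e = (case e of XE _ i \<Rightarrow> yvar i 0 | YE _ _ \<Rightarrow> 0)"

definition root_constant :: "nat \<Rightarrow> entry \<Rightarrow> (entry, 'k::field) mpoly" where
  "root_constant n e = (case e of
       XE _ i \<Rightarrow> xvar i 0 * yvar 0 i + (\<Sum>j=1..<n. xvar i j * yvar j i - yvar i j * xvar j i)
     | YE _ _ \<Rightarrow> 0)"

lemma var_base:
  "i < n \<Longrightarrow> j < n \<Longrightarrow> i \<noteq> 0 \<or> j = 0 \<Longrightarrow> xvar i j \<in> polys (base n)"
  "i < n \<Longrightarrow> j < n \<Longrightarrow> yvar i j \<in> polys (base n)"
  unfolding xvar_def yvar_def by (rule polys_var, force simp: base_def roots_def entries_def)+

lemma weight_le_vars:
  "weight_le total_deg 1 (xvar i j :: (entry, 'k::field) mpoly)"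
  "weight_le total_deg 1 (yvar i j :: (entry, 'k::field) mpoly)"
  by (simp_all add: weight_le_def xvar_def yvar_def mpoly_var_def total_deg_single)

lemma weight_le_diff:
  "weight_le w d p \<Longrightarrow> weight_le w d q \<Longrightarrow> weight_le w d (p - q)"
  using weight_le_add[of w d p "- q"] by (simp add: weight_le_def)

lemma weight_le_quadratic:
  "weight_le total_deg 1 p \<Longrightarrow> weight_le total_deg 1 q \<Longrightarrow> weight_le total_deg 2 (p * q)"
  using weight_le_mult[OF total_deg_add, of 1 p 1 q] by (simp only: one_add_one)

lemma homogeneous_vars:
  "homogeneous 1 (xvar i j :: (entry, 'k::field) mpoly)"
  "homogeneous 1 (yvar i j :: (entry, 'k::field) mpoly)"
  by (simp_all add: homogeneous_def xvar_def yvar_def mpoly_var_def total_deg_single)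

lemma homogeneous_add: "homogeneous d p \<Longrightarrow> homogeneous d q \<Longrightarrow> homogeneous d (p + q)"
  unfolding homogeneous_def using Poly_Mapping.keys_add[of p q] by blast

lemma homogeneous_diff: "homogeneous d p \<Longrightarrow> homogeneous d q \<Longrightarrow> homogeneous d (p - q)"
  using homogeneous_add[of d p "- q"] by (simp add: homogeneous_def)

lemma homogeneous_sum: "(\<And>a. a \<in> A \<Longrightarrow> homogeneous d (F a)) \<Longrightarrow> homogeneous d (sum F A)"
  by (induction A rule: infinite_finite_induct) (auto intro: homogeneous_add simp: homogeneous_def[of _ 0])

lemma homogeneous_mult: "homogeneous d p \<Longrightarrow> homogeneous e q \<Longrightarrow> homogeneous (d + e) (p * q)"
  unfolding homogeneous_def
proof
  fix m assume *: "\<forall>m\<in>Poly_Mapping.keys p. total_deg m = d" "\<forall>m\<in>Poly_Mapping.keys q. total_deg m = e"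
    and "m \<in> Poly_Mapping.keys (p * q)"
  then obtain a b where "a \<in> Poly_Mapping.keys p" "b \<in> Poly_Mapping.keys q" "m = a + b"
    using Poly_Mapping.keys_mult[of p q] by blast
  then show "total_deg m = d + e" using * by (simp add: total_deg_add)
qed

interpretation tower: quadratic_tower "base n" "roots n" root_linear "root_constant n"
  for n
proof
  show "finite (base n)" "finite (roots n)" "base n \<inter> roots n = {}"
    by (auto simp: base_def roots_def finite_entries)
  fix t assume "t \<in> roots n"
  then obtain i where t: "t = XE 0 i" "1 \<le> i" "i < n" by (auto simp: roots_def)
  show "root_linear t \<in> polys (base n)"
    using t by (auto simp: root_linear_def intro: var_base)
  show "root_constant n t \<in> polys (base n)"
    using t by (auto simp: root_constant_def intro!: polys_add polys_sum polys_diff polys_mult var_base)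
  show "weight_le total_deg 1 (root_linear t)"
    using weight_le_vars(2) by (simp add: t root_linear_def)
  show "weight_le total_deg 2 (root_constant n t)"
    by (auto simp: t root_constant_def
      intro!: weight_le_add weight_le_sum weight_le_diff weight_le_quadratic weight_le_vars)
qed

text \<open>The index \<open>0\<close> enters \<open>c\<^bsub>ii\<^esub>\<close> only through the summand \<open>x\<^bsub>i0\<^esub> y\<^bsub>0i\<^esub> - y\<^bsub>i0\<^esub> x\<^bsub>0i\<^esub>\<close>, and \<open>\<sigma>\<close> turns \<open>y\<^bsub>i0\<^esub> x\<^bsub>0i\<^esub>\<close>
  into \<open>x\<^bsub>0i\<^esub>\<^sup>2 - y\<^bsub>i0\<^esub> x\<^bsub>0i\<^esub>\<close>.\<close>
lemma \<sigma>_commutator: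
  assumes "1 \<le> i" "i < n"
  shows "\<sigma> (commutator n $$ (i, i)) = (- tower.quadric n (XE 0 i) :: (entry, 'k::field) mpoly)"
proof -
  have c: "commutator n $$ (i, i) = (xvar i 0 * yvar 0 i - yvar i 0 * xvar 0 i)
      + (\<Sum>j=1..<n. xvar i j * yvar j i - yvar i j * xvar j i :: (entry, 'k) mpoly)"
    using assms by (simp add: commutator_diagonal sum_lessThan_head)
  have "\<sigma> (\<Sum>j=1..<n. xvar i j * yvar j i - yvar i j * xvar j i) =
      (\<Sum>j=1..<n. xvar i j * yvar j i - yvar i j * xvar j i :: (entry, 'k) mpoly)"
    unfolding subst_sum by (rule sum.cong) (use assms in \<open>auto simp: \<sigma>_yvar\<close>)
  then show ?thesis
    unfolding c subst_add using assms
    by (simp add: tower.quadric_def root_linear_def root_constant_def \<sigma>_yvar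
      xvar_def[symmetric] power2_eq_square algebra_simps)
qed

text \<open>Up to sign the quadratics are the images of the \<open>c\<^bsub>ii\<^esub>\<close> with \<open>i \<ge> 1\<close>; the corner entry is
  minus their sum, as the trace of a commutator vanishes. The set \<open>G\<close> leaves room for parameters.\<close>
lemma \<sigma>_ideal:
  fixes G :: "(entry, 'k::field) mpoly set"
  assumes "0 < n" and G: "G \<subseteq> polys (entries n)"
  shows "genideal (mpoly_ring (entries n)) (\<sigma> ` diagonal_entries n \<union> G) =
    genideal (mpoly_ring (entries n)) (tower.quadric n ` roots n \<union> G)"
    (is "?A = ?B")
proof -
  interpret R: cring "mpoly_ring (entries n) :: (entry, 'k) mpoly ring" by (rule cring_mpoly_ring)
  have sub1: "\<sigma> ` diagonal_entries n \<union> G \<subseteq> polys (entries n)"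
    using diagonal_entries_polys \<sigma>_polys G by blast
  have sub2: "tower.quadric n ` roots n \<union> G \<subseteq> polys (entries n)"
    using tower.quadric_polys[of _ n] G unfolding base_roots by blast
  have A: "ideal ?A (mpoly_ring (entries n))" by (rule R.genideal_ideal[OF sub1])
  have B: "ideal ?B (mpoly_ring (entries n))" by (rule R.genideal_ideal[OF sub2])
  note genA = R.genideal_self[OF sub1] and genB = R.genideal_self[OF sub2]
  have quadB: "\<sigma> (commutator n $$ (i, i)) \<in> ?B" if "1 \<le> i" "i < n" for i
  proof -
    have "tower.quadric n (XE 0 i) \<in> ?B" using genB that by (auto simp: roots_def)
    then show ?thesis unfolding \<sigma>_commutator[OF that] by (rule ideal_polys_rules(5)[OF B])
  qed
  have "?A \<subseteq> ?B"
  proof (rule R.genideal_subsetI[OF sub1 B])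
    have "\<sigma> (commutator n $$ (0, 0)) = - (\<Sum>i=1..<n. \<sigma> (commutator n $$ (i, i)) :: (entry, 'k) mpoly)"
      unfolding commutator_corner[OF assms(1)] by (simp add: subst_sum)
    also have "\<dots> \<in> ?B"
      by (rule ideal_polys_rules(5)[OF B], rule ideal_polys_sum[OF B]) (use quadB in auto)
    finally have "\<sigma> (commutator n $$ (0, 0)) \<in> ?B" .
    then have "\<sigma> (commutator n $$ (i, i)) \<in> ?B" if "i < n" for i
      using quadB[of i] that by (cases "i = 0") auto
    then show "\<sigma> ` diagonal_entries n \<union> G \<subseteq> ?B"
      using genB by (auto simp: diagonal_entries_def)
  qed
  moreover have "?B \<subseteq> ?A"
  proof (rule R.genideal_subsetI[OF sub2 A])
    have "tower.quadric n t \<in> ?A" if "t \<in> roots n" for t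
    proof -
      obtain i where i: "t = XE 0 i" "1 \<le> i" "i < n" using \<open>t \<in> roots n\<close> by (auto simp: roots_def)
      have "\<sigma> (commutator n $$ (i, i)) \<in> ?A" using genA i by (auto simp: diagonal_entries_def)
      then have "- \<sigma> (commutator n $$ (i, i)) \<in> ?A" by (rule ideal_polys_rules(5)[OF A])
      then show ?thesis unfolding \<sigma>_commutator[OF i(2,3)] i(1) by simp
    qed
    then show "tower.quadric n ` roots n \<union> G \<subseteq> ?A" using genA by auto
  qed
  ultimately show ?thesis by blast
qed

lemma length_parameters: "0 < n \<Longrightarrow> length (parameters n :: (entry, 'k::field) mpoly list) = card (base n)"
  unfolding card_base
  by (cases n) (simp_all add: parameters_def length_concat comp_def sum_list_triv power2_eq_square
      algebra_simps del: upt_Suc)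

lemma parameters_memI:
  "xvar 0 0 \<in> set (parameters n)"
  "1 \<le> i \<Longrightarrow> i < n \<Longrightarrow> j < n \<Longrightarrow> xvar i j \<in> set (parameters n)"
  "i < n \<Longrightarrow> 1 \<le> j \<Longrightarrow> j < n \<Longrightarrow> yvar i j \<in> set (parameters n)"
  "j < n \<Longrightarrow> xvar 0 j - yvar j 0 \<in> set (parameters n)"
  unfolding parameters_def by (simp, fastforce+)

lemma parameters_cases:
  assumes "f \<in> set (parameters n)"
  obtains "f = xvar 0 0"
    | i j where "1 \<le> i" "i < n" "j < n" "f = xvar i j"
    | i j where "i < n" "1 \<le> j" "j < n" "f = yvar i j"
    | j where "j < n" "f = xvar 0 j - yvar j 0"
  using assms unfolding parameters_def by fastforce

lemma set_parameters:
  assumes "0 < n"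
  shows "set (parameters n) = (\<sigma> \<circ> (mpoly_var :: entry \<Rightarrow> (entry, 'k::field) mpoly)) ` base n"
proof
  show "set (parameters n) \<subseteq> (\<sigma> \<circ> (mpoly_var :: entry \<Rightarrow> (entry, 'k) mpoly)) ` base n"
  proof
    fix f :: "(entry, 'k) mpoly" assume "f \<in> set (parameters n)"
    then show "f \<in> (\<sigma> \<circ> mpoly_var) ` base n"
    proof (cases rule: parameters_cases)
      case 1
      then show ?thesis using assms
        by (intro image_eqI[of _ _ "XE 0 0"]) (auto simp: swap_column_def base_def roots_def entries_def)
    next
      case (2 i j)
      then show ?thesis
        by (intro image_eqI[of _ _ "XE i j"]) (auto simp: swap_column_def base_def roots_def entries_def)
    next
      case (3 i j)
      then show ?thesis
        by (intro image_eqI[of _ _ "YE i j"]) (auto simp: swap_column_def base_def roots_def entries_def)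
    next
      case (4 j)
      then show ?thesis using assms
        by (intro image_eqI[of _ _ "YE j 0"]) (auto simp: swap_column_def base_def roots_def entries_def)
    qed
  qed
  show "(\<sigma> \<circ> (mpoly_var :: entry \<Rightarrow> (entry, 'k) mpoly)) ` base n \<subseteq> set (parameters n)"
  proof (rule image_subsetI)
    fix e assume "e \<in> base n"
    show "(\<sigma> \<circ> (mpoly_var :: entry \<Rightarrow> (entry, 'k) mpoly)) e \<in> set (parameters n)"
    proof (cases e)
      case (XE i j)
      then have "i < n" "j < n" "i = 0 \<Longrightarrow> j = 0"
        using \<open>e \<in> base n\<close> by (auto simp: base_def roots_def entries_def)
      then show ?thesis using XE
        by (cases "i = 0") (auto simp: swap_column_def intro: parameters_memI)
    next
      case (YE i j)
      then have "i < n" "j < n" using \<open>e \<in> base n\<close> by (auto simp: base_def entries_def)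
      then show ?thesis using YE
        by (cases "j = 0") (auto simp: swap_column_def intro: parameters_memI)
    qed
  qed
qed

lemma distinct_parameters:
  assumes "0 < n" shows "distinct (parameters n :: (entry, 'k::field) mpoly list)"
proof (rule card_distinct)
  have "inj_on (\<sigma> \<circ> mpoly_var :: entry \<Rightarrow> (entry, 'k) mpoly) (base n)"
  proof (rule inj_onI)
    fix e e' assume "(\<sigma> \<circ> mpoly_var) e = ((\<sigma> \<circ> mpoly_var) e' :: (entry, 'k) mpoly)"
    then have "\<sigma> (\<sigma> (mpoly_var e)) = (\<sigma> (\<sigma> (mpoly_var e')) :: (entry, 'k) mpoly)" by simp
    then have "mpoly_var e = (mpoly_var e' :: (entry, 'k) mpoly)" by (simp only: \<sigma>_involution)
    then have "Poly_Mapping.keys (mpoly_var e :: (entry, 'k) mpoly) = Poly_Mapping.keys (mpoly_var e' :: (entry, 'k) mpoly)"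
      by (rule arg_cong)
    then have "Poly_Mapping.single e (1 :: nat) = Poly_Mapping.single e' 1" by (simp add: mpoly_var_def)
    then have "Poly_Mapping.keys (Poly_Mapping.single e (1 :: nat)) = Poly_Mapping.keys (Poly_Mapping.single e' (1 :: nat))"
      by (rule arg_cong)
    then show "e = e'" by simp
  qed
  then show "card (set (parameters n :: (entry, 'k) mpoly list)) = length (parameters n :: (entry, 'k) mpoly list)"
    unfolding set_parameters[OF assms] length_parameters[OF assms] by (rule card_image)
qed

section \<open>A parametrization of a component of the zero set\<close>

text \<open>For \<open>i \<ge> 1\<close> the equation \<open>c\<^bsub>ii\<^esub> = 0\<close> is linear in \<open>x\<^bsub>i0\<^esub>\<close> with coefficient \<open>w\<^bsub>i\<^esub> = y\<^bsub>0i\<^esub>\<close>: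
  \<open>w\<^bsub>i\<^esub> x\<^bsub>i0\<^esub> = y\<^bsub>i0\<^esub> x\<^bsub>0i\<^esub> - (\<Sum>j\<ge>1. x\<^bsub>ij\<^esub> y\<^bsub>ji\<^esub> - y\<^bsub>ij\<^esub> x\<^bsub>ji\<^esub>)\<close>.
  To solve it without denominators, \<open>x\<^bsub>0i\<^esub>\<close> is replaced by \<open>w\<^bsub>i\<^esub> x\<^bsub>0i\<^esub>\<close> and \<open>x\<^bsub>ij\<^esub>\<close> by \<open>w\<^bsub>i\<^esub> w\<^bsub>j\<^esub> x\<^bsub>ij\<^esub>\<close> for
  \<open>i, j \<ge> 1\<close>, after which \<open>w\<^bsub>i\<^esub>\<close> divides the right-hand side. All entries other than the \<open>x\<^bsub>i0\<^esub>\<close> with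
  \<open>i \<ge> 1\<close> are free parameters. The \<open>w\<^bsub>i\<^esub>\<close> are numbered first: once they are specialized to \<open>1\<close>, every
  other free coordinate equals its own parameter.\<close>
lemma exists_parametrization:
  assumes n: "0 < n"
  shows "\<exists>(g :: entry \<Rightarrow> (nat, 'k::field) mpoly) v.
    (\<forall>k < card (base n). v k \<in> entries n \<and> specialize k (g (v k)) = mpoly_var k) \<and>
    (\<forall>q\<in>diagonal_entries n. subst g q = 0)"
proof -
  define W where "W = map (YE 0) [1..<n]"
  define S where "S = entries n - (\<lambda>i. XE i 0) ` {1..<n} - set W"
  obtain rest where rest: "set rest = S" "distinct rest"
    using finite_distinct_list[of S] finite_entries by (auto simp: S_def)
  define zs where "zs = W @ rest"
  have W: "length W = n - 1" "\<And>k. k < n - 1 \<Longrightarrow> W ! k = YE 0 (Suc k)" "distinct W"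
    by (auto simp: W_def distinct_map inj_on_def)
  have "distinct zs" unfolding zs_def using rest W(3) by (auto simp: S_def)
  have setzs: "set zs = entries n - (\<lambda>i. XE i 0) ` {1..<n}"
    unfolding zs_def using rest by (auto simp: S_def W_def entries_def)
  have len: "length zs = card (base n)"
  proof -
    have "length zs = card (set zs)" using \<open>distinct zs\<close> by (simp add: distinct_card)
    also have "\<dots> = card (entries n) - card ((\<lambda>i. XE i 0) ` {1..<n})"
      unfolding setzs by (rule card_Diff_subset) (auto simp: entries_def)
    also have "card ((\<lambda>i. XE i 0) ` {1..<n}) = n - 1"
      by (subst card_image) (auto simp: inj_on_def)
    finally show ?thesis by (simp add: card_entries card_base)
  qed
  define pos where "pos e = inv_into {..<length zs} ((!) zs) e" for e
  have pos: "pos (zs ! k) = k" if "k < length zs" for k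
    unfolding pos_def using \<open>distinct zs\<close> that
    by (intro inv_into_f_f) (auto simp: inj_on_def nth_eq_iff_index_eq)
  define z :: "entry \<Rightarrow> (nat, 'k) mpoly" where "z e = mpoly_var (pos e)" for e
  define w where "w i = z (YE 0 i)" for i
  have nth_w: "zs ! k = YE 0 (Suc k)" if "k < n - 1" for k
    using that W by (simp add: zs_def nth_append)
  have w: "w i = mpoly_var (i - 1)" if "1 \<le> i" "i < n" for i
  proof -
    have "i - 1 < length zs" using that W(1) by (simp add: zs_def)
    moreover have "zs ! (i - 1) = YE 0 i" using nth_w[of "i - 1"] that by simp
    ultimately have "pos (YE 0 i) = i - 1" using pos[of "i - 1"] by simp
    then show ?thesis by (simp add: w_def z_def)
  qed
  define g :: "entry \<Rightarrow> (nat, 'k) mpoly" where "g e = (case e of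
      YE i j \<Rightarrow> z e
    | XE i j \<Rightarrow>
        if i = 0 then (if j = 0 then z e else w j * z e)
        else if j = 0 then z (YE i 0) * z (XE 0 i)
          - (\<Sum>k=1..<n. w k * (z (XE i k) * z (YE k i) - z (YE i k) * z (XE k i)))
        else w i * w j * z e)" for e
  have gx: "subst g (xvar i j) = g (XE i j)" and gy: "subst g (yvar i j) = z (YE i j)" for i j
    by (simp_all add: xvar_def yvar_def g_def[of "YE i j"])
  have diag: "subst g (commutator n $$ (i, i)) = 0" if i: "1 \<le> i" "i < n" for i
  proof -
    have tail: "(\<Sum>j=1..<n. g (XE i j) * z (YE j i) - z (YE i j) * g (XE j i)) =
      w i * (\<Sum>j=1..<n. w j * (z (XE i j) * z (YE j i) - z (YE i j) * z (XE j i)))"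
      unfolding sum_distrib_left by (rule sum.cong) (use i in \<open>auto simp: g_def algebra_simps\<close>)
    have "subst g (commutator n $$ (i, i)) = g (XE i 0) * z (YE 0 i) - z (YE i 0) * g (XE 0 i)
        + (\<Sum>j=1..<n. g (XE i j) * z (YE j i) - z (YE i j) * g (XE j i))"
      using i by (simp add: commutator_diagonal sum_lessThan_head subst_sum gx gy)
    also have "\<dots> = 0"
      unfolding tail using i by (simp add: g_def[of "XE i 0"] g_def[of "XE 0 i"] w_def[symmetric] algebra_simps)
    finally show ?thesis .
  qed
  have corner: "subst g (commutator n $$ (0, 0)) = 0"
    unfolding commutator_corner[OF n] using diag by (simp add: subst_sum)
  have zero: "subst g q = 0" if "q \<in> diagonal_entries n" for q
  proof -
    obtain i where i: "i < n" "q = commutator n $$ (i, i)"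
      using \<open>q \<in> diagonal_entries n\<close> unfolding diagonal_entries_def by blast
    show ?thesis using corner diag[of i] i by (cases "i = 0") auto
  qed
  have coord: "specialize k (g (zs ! k)) = mpoly_var k" if k: "k < length zs" for k
  proof -
    have zk: "z (zs ! k) = mpoly_var k" by (simp add: z_def pos[OF k])
    have self: "specialize k (mpoly_var k :: (nat, 'k) mpoly) = mpoly_var k"
      by (simp add: specialize_def)
    show ?thesis
    proof (cases "k < n - 1")
      case True
      then have "g (zs ! k) = z (zs ! k)" by (simp add: nth_w g_def)
      then show ?thesis using zk self by simp
    next
      case False
      have w1: "specialize k (w i) = 1" if "1 \<le> i" "i < n" for i
        using False that by (simp add: w[OF that] specialize_def)
      have in_zs: "zs ! k \<in> set zs" using k by simp
      show ?thesis
      proof (cases "zs ! k")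
        case (XE i j)
        then have "i < n" "j < n" "i \<noteq> 0 \<Longrightarrow> j \<noteq> 0"
          using in_zs unfolding setzs by (auto simp: entries_def)
        then have "specialize k (g (zs ! k)) = specialize k (z (zs ! k))"
          using XE w1[of i] w1[of j]
          by (cases "i = 0"; cases "j = 0") (simp_all add: g_def specialize_def)
        then show ?thesis using zk self by simp
      next
        case (YE i j)
        then have "g (zs ! k) = z (zs ! k)" by (simp add: g_def)
        then show ?thesis using zk self by simp
      qed
    qed
  qed
  have "zs ! k \<in> entries n" if "k < length zs" for k
    using nth_mem[OF that] unfolding setzs by blast
  then show ?thesis
    using coord zero len by (intro exI[of _ g] exI[of _ "(!) zs"]) auto
qed

section \<open>Parameters and dimension\<close>

text \<open>Modulo the parameters, \<open>c\<^bsub>ii\<^esub>\<close> becomes \<open>- y\<^bsub>i0\<^esub> x\<^bsub>0i\<^esub>\<close>, and \<open>y\<^bsub>i0\<^esub>\<close> and \<open>x\<^bsub>0i\<^esub>\<close> are identified; so a prime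
  contains both.\<close>
lemma primes_over_parameters:
  fixes P :: "(entry, 'k::field) mpoly set"
  assumes n: "0 < n" and P: "primeideal P (mpoly_ring (entries n))"
    and diag: "diagonal_entries n \<subseteq> P" and params: "set (parameters n) \<subseteq> P"
  shows "P = {p \<in> polys (entries n). Poly_Mapping.lookup p 0 = 0}"
proof (rule prime_containing_variables[OF P])
  have id: "ideal P (mpoly_ring (entries n))" by (rule primeideal.axioms(1)[OF P])
  note rules = ideal_polys_rules[OF id]
  have x: "xvar i j \<in> P" if "i < n" "j < n" "i \<noteq> 0 \<or> j = 0" for i j
    using that params parameters_memI(1)[of n] parameters_memI(2)[of i n j] by (cases "i = 0") auto
  have y: "yvar i j \<in> P" if "i < n" "j < n" "j \<noteq> 0" for i j
    using that params parameters_memI(3)[of i n j] by auto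
  have xy: "xvar 0 j - yvar j 0 \<in> P" if "j < n" for j
    using that params parameters_memI(4)[of j n] by auto
  have x0: "xvar 0 i \<in> P" if i: "i < n" for i
  proof (cases "i = 0")
    case False
    have "(\<Sum>j=1..<n. xvar i j * yvar j i - yvar i j * xvar j i) \<in> P"
    proof (rule ideal_polys_sum[OF id])
      fix j assume "j \<in> {1..<n}"
      then show "xvar i j * yvar j i - yvar i j * xvar j i \<in> P"
        using i False x[of j i] y[of j i] var_entries[of i n j]
        by (intro rules(6) rules(4)) auto
    qed
    moreover have "xvar i 0 * yvar 0 i \<in> P"
      using i False y[of 0 i] var_entries(1)[of i n 0] by (intro rules(4)) auto
    moreover have "commutator n $$ (i, i) \<in> P" using diag i by (auto simp: diagonal_entries_def)
    moreover have "yvar i 0 * xvar 0 i = xvar i 0 * yvar 0 i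
      + (\<Sum>j=1..<n. xvar i j * yvar j i - yvar i j * xvar j i) - (commutator n $$ (i, i) :: (entry, 'k) mpoly)"
      using i n by (simp add: commutator_diagonal sum_lessThan_head)
    ultimately have "yvar i 0 * xvar 0 i \<in> P" using rules(3,6) by simp
    then consider "yvar i 0 \<in> P" | "xvar 0 i \<in> P"
      using primeideal_polys[OF P var_entries(2)[OF i n] var_entries(1)[OF n i]] by blast
    then show ?thesis
    proof cases
      case 1
      then have "(xvar 0 i - yvar i 0) + yvar i 0 \<in> P" by (rule rules(3)[OF xy[OF i]])
      then show ?thesis by simp
    qed
  qed (use x[of 0 0] n in simp)
  have y0: "yvar i 0 \<in> P" if "i < n" for i
    using rules(6)[OF x0[OF that] xy[OF that]] by simp
  show "mpoly_var ` entries n \<subseteq> P"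
  proof (rule image_subsetI)
    fix e assume "e \<in> entries n"
    show "mpoly_var e \<in> P"
    proof (cases e)
      case (XE i j)
      then have "i < n" "j < n" using \<open>e \<in> entries n\<close> by (auto simp: entries_def)
      then have "xvar i j \<in> P" using x[of i j] x0[of j] by (cases "i = 0") auto
      then show ?thesis by (simp add: XE xvar_def)
    next
      case (YE i j)
      then have "i < n" "j < n" using \<open>e \<in> entries n\<close> by (auto simp: entries_def)
      then have "yvar i j \<in> P" using y[of i j] y0[of i] by (cases "j = 0") auto
      then show ?thesis by (simp add: YE yvar_def)
    qed
  qed
qed

theorem theorem4p3:
  fixes n :: nat and fs :: "(entry, 'k::field) mpoly list"
  assumes "n \<ge> 3" and "mset fs = mset (parameters n)"
  shows "hsop (entries n) (diag_ideal n) (map (\<lambda>f. diag_ideal n +>\<^bsub>polyR n\<^esub> f) fs)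
    \<and> regular_sequence (polyR n Quot diag_ideal n) (map (\<lambda>f. diag_ideal n +>\<^bsub>polyR n\<^esub> f) fs)"
proof -
  have n: "0 < n" using assms(1) by simp
  define V where "V = entries n"
  define R where "R = (mpoly_ring V :: (entry, 'k) mpoly ring)"
  define D where "D = (diagonal_entries n :: (entry, 'k) mpoly set)"
  define \<MM> where "\<MM> = {p \<in> polys V. Poly_Mapping.lookup p 0 = (0 :: 'k)}"
  have R: "polyR n = R" by (simp add: R_def V_def polyR_def)
  have I: "diag_ideal n = genideal R D"
    by (simp add: diag_ideal_def R D_def diagonal_entries_def)
  interpret R: cring R unfolding R_def by (rule cring_mpoly_ring)
  have VV: "base n \<union> roots n = V" unfolding V_def by (rule base_roots)
  have D: "D \<subseteq> carrier R" unfolding D_def R_def V_def by (rule diagonal_entries_polys)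
  have set_fs: "set fs = (\<sigma> \<circ> mpoly_var) ` base n"
    using assms(2) set_parameters[OF n] by (metis set_mset_mset)
  have fs_params: "set fs = set (parameters n)" using assms(2) by (metis set_mset_mset)
  have distinct: "distinct fs"
    using assms(2) distinct_parameters[OF n] by (metis distinct_count_atmost_1 count_mset set_mset_mset)
  have len: "length fs = card (base n)"
    using assms(2) length_parameters[OF n] by (metis size_mset)
  have \<sigma>_carrier: "\<sigma> p \<in> carrier R" if "p \<in> carrier R" for p
    using \<sigma>_polys that by (simp add: R_def V_def)
  have fs_carrier: "set fs \<subseteq> carrier R"
  proof
    fix f assume "f \<in> set fs"
    then obtain e where e: "e \<in> base n" "f = \<sigma> (mpoly_var e)" unfolding set_fs by auto
    have "mpoly_var e \<in> carrier R" using e(1) by (simp add: R_def V_def base_def)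
    then show "f \<in> carrier R" unfolding e(2) by (rule \<sigma>_carrier)
  qed
  \<comment> \<open>Membership in an ideal generated by the diagonal entries and some parameters is transported by
    \<open>\<sigma>\<close> to the tower of quadratic extensions, where the parameters are variables.\<close>
  have to_tower: "p \<in> genideal R (D \<union> (\<sigma> \<circ> mpoly_var) ` F) \<longleftrightarrow>
      \<sigma> p \<in> genideal R (tower.quadric n ` roots n \<union> mpoly_var ` F)"
    if F: "F \<subseteq> base n" and p: "p \<in> carrier R" for F p
  proof -
    let ?G = "mpoly_var ` F :: (entry, 'k) mpoly set"
    have G: "?G \<subseteq> polys (entries n)" using F by (auto simp: base_def intro!: polys_var)
    have eq: "genideal R (\<sigma> ` D \<union> ?G) = genideal R (tower.quadric n ` roots n \<union> ?G)"
      using \<sigma>_ideal[OF n G] by (simp add: R_def V_def D_def)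
    have sub: "D \<union> \<sigma> ` ?G \<subseteq> polys V" "\<sigma> ` D \<union> ?G \<subseteq> polys V"
      using D G \<sigma>_carrier by (auto simp: R_def V_def)
    have 1: "\<sigma> ` (D \<union> \<sigma> ` ?G) = \<sigma> ` D \<union> ?G" "\<sigma> ` (\<sigma> ` D \<union> ?G) = D \<union> \<sigma> ` ?G"
      by (simp_all add: image_Un image_image del: subst_var)
    have "p \<in> genideal R (D \<union> \<sigma> ` ?G) \<longleftrightarrow> \<sigma> p \<in> genideal R (\<sigma> ` D \<union> ?G)"
    proof
      assume "p \<in> genideal R (D \<union> \<sigma> ` ?G)"
      then show "\<sigma> p \<in> genideal R (\<sigma> ` D \<union> ?G)"
        using genideal_subst[where g = swap_column, OF swap_column_polys sub(1)[unfolded V_def], where p = p] unfolding 1 R_def V_def by blast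
    next
      assume "\<sigma> p \<in> genideal R (\<sigma> ` D \<union> ?G)"
      then have "\<sigma> (\<sigma> p) \<in> genideal R (D \<union> \<sigma> ` ?G)"
        using genideal_subst[where g = swap_column, OF swap_column_polys sub(2)[unfolded V_def], where p = "\<sigma> p"] unfolding 1 R_def V_def by blast
      then show "p \<in> genideal R (D \<union> \<sigma> ` ?G)" by simp
    qed
    then show ?thesis unfolding eq by (simp add: image_comp)
  qed
  have max_prime: "primeideal \<MM> R"
  proof -
    have "\<MM> = {p \<in> polys V. subst (\<lambda>_. 0 :: (nat, 'k) mpoly) p = 0}"
      unfolding \<MM>_def subst_zero_eq by (auto simp: scalar_eq_0_iff)
    then show ?thesis unfolding R_def by (simp only: primeideal_subst_kernel)
  qed
  have max_gens: "D \<union> set fs \<subseteq> \<MM>"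
  proof
    let ?o = "subst (\<lambda>_. 0 :: (nat, 'k) mpoly)"
    fix f assume f: "f \<in> D \<union> set fs"
    have x: "?o (xvar i j) = 0" and y: "?o (yvar i j) = 0" for i j
      by (simp_all add: xvar_def yvar_def)
    have "?o f = 0"
    proof (cases "f \<in> D")
      case True
      then obtain i where i: "i < n" "f = commutator n $$ (i, i)"
        unfolding D_def diagonal_entries_def by blast
      show ?thesis unfolding i(2) commutator_diagonal[OF i(1)] by (simp add: subst_sum x y)
    next
      case False
      then have "f \<in> set (parameters n)" using f fs_params by blast
      then show ?thesis by (cases rule: parameters_cases) (simp_all add: x y)
    qed
    moreover have "f \<in> carrier R" using f D fs_carrier by blast
    ultimately show "f \<in> \<MM>" by (simp add: \<MM>_def subst_zero_eq scalar_eq_0_iff R_def)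
  qed
  have max_ideal: "genideal R (D \<union> set fs) \<subseteq> \<MM>"
    using R.genideal_subsetI[OF _ primeideal.axioms(1)[OF max_prime] max_gens] D fs_carrier by blast
  define I where "I = genideal R D"
  have I_ideal: "ideal I R" unfolding I_def by (rule R.genideal_ideal[OF D])
  note proj = ideal.rcos_ring_hom_ring[OF I_ideal]
  have A: "cring (R Quot I)" by (rule ideal.quotient_is_cring[OF I_ideal R.is_cring])
  have ker: "I +>\<^bsub>R\<^esub> p = \<zero>\<^bsub>R Quot I\<^esub> \<longleftrightarrow> p \<in> I" if "p \<in> carrier R" for p
    unfolding zero_Quot by (rule R.quotient_zero_iff[OF I_ideal that])
  have \<sigma>_hom: "\<sigma> \<in> Ring.ring_hom R R"
    by (rule ring_hom_memI) (use \<sigma>_carrier in \<open>auto simp: R_def\<close>)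
  have \<sigma>_surj: "\<sigma> ` carrier R = carrier R"
  proof
    show "carrier R \<subseteq> \<sigma> ` carrier R"
    proof
      fix p assume "p \<in> carrier R"
      then have "\<sigma> (\<sigma> p) \<in> \<sigma> ` carrier R" using \<sigma>_carrier by blast
      then show "p \<in> \<sigma> ` carrier R" by simp
    qed
  qed (use \<sigma>_carrier in auto)
  have dim_le: "krull_dim (R Quot I) \<le> ereal (real (card (base n)))"
  proof -
    \<comment> \<open>Viewing \<open>R/I\<close> as an image of \<open>R\<close> through \<open>\<sigma>\<close> puts the quadratics into the kernel.\<close>
    let ?h = "(+>\<^bsub>R\<^esub>) I \<circ> \<sigma>"
    have h: "ring_hom_ring R (R Quot I) ?h"
      by (rule ring_hom_ringI2[OF R.ring_axioms cring.axioms(1)[OF A]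
            ring_hom_trans[OF \<sigma>_hom ideal.rcos_ring_hom[OF I_ideal]]])
    have surj: "?h ` carrier R = carrier (R Quot I)"
      unfolding image_comp[symmetric] \<sigma>_surj surj_quotient ..
    have quad: "tower.quadric n t \<in> {r \<in> carrier R. ?h r = \<zero>\<^bsub>R Quot I\<^esub>}" if t: "t \<in> roots n" for t
    proof -
      have q: "tower.quadric n t \<in> carrier R"
        using tower.quadric_polys[OF t] by (simp add: R_def VV)
      have "tower.quadric n ` roots n \<subseteq> carrier R"
        using tower.quadric_polys[of _ n] unfolding R_def VV by blast
      then have "tower.quadric n t \<in> genideal R (tower.quadric n ` roots n)"
        using R.genideal_self t by blast
      then have "\<sigma> (tower.quadric n t) \<in> I"
        using to_tower[of "{}" "\<sigma> (tower.quadric n t)"] \<sigma>_carrier[OF q] by (simp add: I_def)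
      then show ?thesis using q ker \<sigma>_carrier by simp
    qed
    show ?thesis
      unfolding krull_dim_surjective_image[OF h R.is_cring A surj]
    proof (rule Sup_least)
      fix e assume "e \<in> {ereal (real d) | d. \<exists>P :: nat \<Rightarrow> (entry, 'k) mpoly set.
        (\<forall>i\<le>d. primeideal (P i) R \<and> {r \<in> carrier R. ?h r = \<zero>\<^bsub>R Quot I\<^esub>} \<subseteq> P i) \<and>
        (\<forall>i<d. P i \<subset> P (Suc i))}"
      then obtain d and P :: "nat \<Rightarrow> (entry, 'k) mpoly set" where e: "e = ereal (real d)"
        and P: "\<forall>i\<le>d. primeideal (P i) R \<and> {r \<in> carrier R. ?h r = \<zero>\<^bsub>R Quot I\<^esub>} \<subseteq> P i"
          "\<forall>i<d. P i \<subset> P (Suc i)" by blast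
      have "d \<le> card (base n)"
      proof (rule tower.prime_chain_length_le)
        show "primeideal (P i) (mpoly_ring (base n \<union> roots n))" if "i \<le> d" for i
          using P(1) that by (simp add: VV R_def)
        show "P i \<subset> P (Suc i)" if "i < d" for i using P(2) that by blast
        show "tower.quadric n t \<in> P 0" if "t \<in> roots n" for t using P(1) quad[OF that] by blast
      qed
      then show "e \<le> ereal (real (card (base n)))" by (simp add: e)
    qed
  qed
  have dim_ge: "ereal (real (card (base n))) \<le> krull_dim (R Quot I)"
  proof -
    obtain g :: "entry \<Rightarrow> (nat, 'k) mpoly" and v where
      v: "\<And>k. k < card (base n) \<Longrightarrow> v k \<in> V"
        "\<And>k. k < card (base n) \<Longrightarrow> specialize k (g (v k)) = mpoly_var k"
      and zero: "\<And>q. q \<in> D \<Longrightarrow> subst g q = 0"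
      using exists_parametrization[OF n] unfolding V_def D_def by blast
    define P where "P k = {p \<in> polys V. specialize k (subst g p) = 0}" for k
    note chain = prime_chain_of_parametrization[OF v, folded P_def R_def]
    have "I \<subseteq> {p \<in> polys V. subst g p = 0}"
      unfolding I_def
    proof (rule R.genideal_subsetI[OF D])
      show "ideal {p \<in> polys V. subst g p = 0} R"
        unfolding R_def by (rule primeideal.axioms(1)[OF primeideal_subst_kernel])
      show "D \<subseteq> {p \<in> polys V. subst g p = 0}" using D zero by (auto simp: R_def)
    qed
    then have "{r \<in> carrier R. I +>\<^bsub>R\<^esub> r = \<zero>\<^bsub>R Quot I\<^esub>} \<subseteq> P i" for i
      using chain(3) ker by blast
    then have "\<exists>P :: nat \<Rightarrow> (entry, 'k) mpoly set. (\<forall>i\<le>card (base n). primeideal (P i) R \<and>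
        {r \<in> carrier R. I +>\<^bsub>R\<^esub> r = \<zero>\<^bsub>R Quot I\<^esub>} \<subseteq> P i) \<and> (\<forall>i<card (base n). P i \<subset> P (Suc i))"
      using chain(1,2) by (intro exI[of _ P]) blast
    then show ?thesis
      unfolding krull_dim_surjective_image[OF proj R.is_cring A surj_quotient]
      by (intro Sup_upper) blast
  qed
  have dim: "krull_dim (R Quot I) = ereal (real (length fs))"
    using dim_le dim_ge len by (simp add: antisym)
  have dim0: "krull_dim (R Quot I Quot genideal (R Quot I) ((+>\<^bsub>R\<^esub>) I ` set fs)) = 0"
  proof -
    let ?Q = "R Quot I Quot genideal (R Quot I) ((+>\<^bsub>R\<^esub>) I ` set fs)"
    let ?h = "\<lambda>r. genideal (R Quot I) ((+>\<^bsub>R\<^esub>) I ` set fs) +>\<^bsub>R Quot I\<^esub> (I +>\<^bsub>R\<^esub> r)"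
    note hom = R.double_quotient_hom[OF D fs_carrier, folded I_def]
    let ?K = "{r \<in> carrier R. ?h r = \<zero>\<^bsub>?Q\<^esub>}"
    have K: "?K = genideal R (D \<union> set fs)"
    proof -
      have "genideal R (D \<union> set fs) \<subseteq> carrier R" using max_ideal by (auto simp: \<MM>_def R_def)
      then show ?thesis using hom(6) by blast
    qed
    have unique: "P = \<MM>" if P: "primeideal P R" "?K \<subseteq> P" for P
    proof -
      have "D \<union> set fs \<subseteq> P"
        using R.genideal_self[of "D \<union> set fs"] D fs_carrier P(2) unfolding K by blast
      then show ?thesis
        using primes_over_parameters[OF n, of P] P(1) fs_params
        by (simp add: R_def V_def D_def \<MM>_def)
    qed
    have "(\<exists>P :: nat \<Rightarrow> (entry, 'k) mpoly set. (\<forall>i\<le>d. primeideal (P i) R \<and> ?K \<subseteq> P i) \<and>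
        (\<forall>i<d. P i \<subset> P (Suc i))) \<longleftrightarrow> d = 0" (is "?L \<longleftrightarrow> _") for d
    proof
      assume ?L
      then obtain P :: "nat \<Rightarrow> (entry, 'k) mpoly set" where
        P: "\<And>i. i \<le> d \<Longrightarrow> primeideal (P i) R \<and> ?K \<subseteq> P i" "\<And>i. i < d \<Longrightarrow> P i \<subset> P (Suc i)"
        by blast
      show "d = 0"
      proof (rule ccontr)
        assume "d \<noteq> 0"
        then have "P 0 = \<MM>" "P (Suc 0) = \<MM>" "P 0 \<subset> P (Suc 0)"
          using unique P(1)[of 0] P(1)[of "Suc 0"] P(2)[of 0] by simp_all
        then show False by blast
      qed
    next
      assume "d = 0"
      moreover have "?K \<subseteq> \<MM>" unfolding K by (rule max_ideal)
      ultimately show ?L using max_prime by (intro exI[of _ "\<lambda>_. \<MM>"]) simp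
    qed
    then show ?thesis
      unfolding krull_dim_surjective_image[OF hom(4) R.is_cring hom(2) hom(5)] by simp
  qed
  have regular: "regular_sequence (R Quot I) (map ((+>\<^bsub>R\<^esub>) I) fs)"
    unfolding I_def
  proof (rule R.regular_sequence_quotientI[OF D fs_carrier])
    show "genideal R (D \<union> set fs) \<noteq> carrier R"
      using max_ideal primeideal.I_notcarr[OF max_prime] primeideal.axioms(1)[OF max_prime]
        ideal_polys_rules(1)[of \<MM> V] by (auto simp: R_def)
    fix i r
    assume i: "i < length fs" and r: "r \<in> carrier R"
      and fr: "fs ! i \<otimes>\<^bsub>R\<^esub> r \<in> genideal R (D \<union> set (take i fs))"
    define F where "F = {e \<in> base n. \<sigma> (mpoly_var e) \<in> set (take i fs)}"
    have F: "set (take i fs) = (\<sigma> \<circ> mpoly_var) ` F"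
      using set_take_subset[of i fs] unfolding set_fs F_def by auto
    have "F \<subseteq> base n" by (auto simp: F_def)
    have "fs ! i \<in> set fs" using i by simp
    then obtain z where z: "z \<in> base n" "fs ! i = \<sigma> (mpoly_var z)" unfolding set_fs by auto
    have "fs ! i \<notin> set (take i fs)"
      using distinct i by (auto simp: in_set_conv_nth nth_eq_iff_index_eq)
    then have "z \<notin> F" using z by (simp add: F_def)
    have fsr: "\<sigma> (mpoly_var z) * r \<in> carrier R"
      using R.m_closed[OF subsetD[OF fs_carrier \<open>fs ! i \<in> set fs\<close>] r] by (simp add: R_def z(2))
    have "\<sigma> (mpoly_var z) * r \<in> genideal R (D \<union> (\<sigma> \<circ> mpoly_var) ` F)"
      using fr z(2) by (simp add: R_def F)
    then have "mpoly_var z * \<sigma> r \<in> genideal R (tower.quadric n ` roots n \<union> mpoly_var ` F)"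
      using to_tower[OF \<open>F \<subseteq> base n\<close> fsr] by (simp del: subst_var)
    then have "\<sigma> r \<in> genideal R (tower.quadric n ` roots n \<union> mpoly_var ` F)"
      using tower.base_variable_cancel[OF \<open>F \<subseteq> base n\<close> z(1) \<open>z \<notin> F\<close>, of "\<sigma> r"] \<sigma>_carrier[OF r]
      by (simp add: VV R_def)
    then show "r \<in> genideal R (D \<union> set (take i fs))"
      unfolding F using to_tower[OF \<open>F \<subseteq> base n\<close> r] by simp
  qed
  have homogeneous: "homogeneous_ideal (entries n) (diag_ideal n :: (entry, 'k) mpoly set)"
    unfolding homogeneous_ideal_def
  proof (intro exI[of _ D] conjI ballI)
    show "D \<subseteq> polys (entries n)" using D by (simp add: R_def V_def)
    show "diag_ideal n = genideal (mpoly_ring (entries n)) D" using I by (simp add: R_def V_def)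
    fix p assume "p \<in> D"
    then obtain i where i: "i < n" "p = commutator n $$ (i, i)"
      unfolding D_def diagonal_entries_def by blast
    have "homogeneous 2 p"
      unfolding i(2) commutator_diagonal[OF i(1)]
      using homogeneous_mult[OF homogeneous_vars(1) homogeneous_vars(2)]
        homogeneous_mult[OF homogeneous_vars(2) homogeneous_vars(1)]
      by (intro homogeneous_sum homogeneous_diff) (simp_all only: one_add_one)
    then show "\<exists>d. homogeneous d p" by blast
  qed
  have degree1: "\<exists>d>0. g \<in> quot_degree_part (entries n) (diag_ideal n) d"
    if "g \<in> set (map ((+>\<^bsub>R\<^esub>) I) fs)" for g
  proof -
    obtain f where f: "f \<in> set fs" "g = I +>\<^bsub>R\<^esub> f"
      using \<open>g \<in> set (map ((+>\<^bsub>R\<^esub>) I) fs)\<close> by auto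
    have "homogeneous 1 f"
      using f(1) unfolding fs_params
      by (cases rule: parameters_cases) (auto intro: homogeneous_vars[unfolded One_nat_def] homogeneous_diff)
    then have "g \<in> quot_degree_part (entries n) (diag_ideal n) 1"
      using f fs_carrier by (auto simp: quot_degree_part_def I I_def R_def V_def)
    then show ?thesis by blast
  qed
  show ?thesis
    unfolding hsop_def Let_def R I I_def[symmetric]
    using regular homogeneous degree1 dim dim0
    by (simp add: R_def V_def I I_def)
qed

end
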